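(* Under the standing assumptions below, suppose in addition that $\liminf_{x\to\infty}h(x)>0$. Then there exist $\epsilon>0$ and constants $c>0$, $C<\infty$ such that, putting $M(x)=\sup_{1/\epsilon\le y\le x}h(y)$ for $x\ge1/\epsilon$, one has $M(x)<\infty$ for every such $x$, and for every $\eta\in(0,1]$ (with $C$ allowed to depend on $\eta$) and every pair of integers $m\ge1$, $n>m+\epsilon^{-\alpha/(\alpha+1)}$, $$b_mb_n\Big|P(S_m=\kappa_m,S_n=\kappa_n)-P(S_m=\kappa_m)P(S_n=\kappa_n)\Big|\le C L(n)\Big\{n^{1/\alpha}\big(e^{-(n-m)c}+e^{-nc}\big)+\frac{m/n}{(1-\frac mn)^{1+\frac1\alpha}}\big(1+M(n^{1+\frac1\alpha})\big)+\frac{(\frac mn)^{\eta/\alpha}L^\eta(m)}{(1-\frac mn)^{\frac{\eta+1}{\alpha}}}\Big\}.$$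
   Context: Standing assumptions: $(X_n)_{n\ge1}$ are i.i.d. real random variables whose common distribution $F$ is supported on a lattice $\{a+k:\ k\in\mathbb Z\}$ ($a\in\mathbb R$) with maximal span $1$; $S_n=X_1+\dots+X_n$. There exist $\alpha\in(0,2]$ with $\alpha\neq1$, constants $c_1,c_2\ge0$ with $c_1+c_2>0$, and a function $l$ slowly varying at infinity such that, as $x\to\infty$, $x^\alpha P(X_1>x)=(c_1+o(1))l(x)$ and $x^\alpha P(X_1\le -x)=(c_2+o(1))l(x)$. If $\alpha>1$, $E[X_1]=0$. Then $F$ is in the domain of attraction of an $\alpha$-stable law $G$: with $b_n=L(n)n^{1/\alpha}$, where $L$ is slowly varying, $S_n/b_n$ converges in distribution to $G$ (no centering constants needed). The characteristic function $\phi$ of $X_1$ satisfies, as $t\to0$, $\phi(t)=\exp\{-c|t|^\alpha h(1/|t|)(1-i\beta\,\mathrm{sign}(t)\tan\frac{\pi\alpha}{2})+o(|t|^\alpha h(1/|t|))\}$, where for $\alpha<2$: $h=l$, $c=\Gamma(1-\alpha)(c_1+c_2)\cos\frac{\pi\alpha}{2}>0$, $\beta=\frac{c_1-c_2}{c_1+c_2}$; and for $\alpha=2$: $c=1/2$, $\beta=0$, $h(x)=E[X_1^2\mathbf 1_{\{|X_1|\le x\}}]$. The function $h$ is slowly varying, determined up to asymptotic equivalence, and is chosen continuous on $[a_0,\infty)$ for some $a_0>0$; moreover $L(n)=h^{1/\alpha}(b_n)$ if $\alpha<2$ and $L(n)=\sqrt{h(b_n)}$ if $\alpha=2$. For each $n$,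 $\kappa_n$ is a point of the lattice $\{na+k:\ k\in\mathbb Z\}$ (where $S_n$ takes values), and $\kappa_n/b_n\to\kappa\in\mathbb R$ as $n\to\infty$. *)

theory Defs
  imports "HOL-Probability.Probability" "HOL-Library.Landau_Symbols"
begin

definition slowly_varying :: "(real \<Rightarrow> real) \<Rightarrow> bool" where
  "slowly_varying l \<longleftrightarrow>
     l \<in> borel_measurable borel \<and>
     (\<forall>\<^sub>F x in at_top. l x > 0) \<and>
     (\<forall>t>0. ((\<lambda>x. l (t * x) / l x) \<longlongrightarrow> 1) at_top)"

definition lattice_pts :: "real \<Rightarrow> real \<Rightarrow> real set" where
  "lattice_pts a d = {a + d * of_int k | k. True}"

end

theory Submission
  imports Defs
begin

text \<open>
  By independence the covariance is \<open>P(S\<^sub>m = \<kappa>\<^sub>m) (P(S\<^sub>n - S\<^sub>m = \<kappa>\<^sub>n - \<kappa>\<^sub>m) - P(S\<^sub>n = \<kappa>\<^sub>n))\<close>.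
  With \<open>\<phi>\<close> the characteristic function of \<open>X\<^sub>1\<close>, Fourier inversion on the lattice bounds the first
  factor by the integral of \<open>|\<phi>|\<^sup>m\<close> over a period, which is \<open>O(1/b\<^sub>m)\<close>, and the second by that of
  \<open>|\<phi>(t)|\<close> to the power \<open>n - m\<close> times \<open>|exp(i t \<kappa>\<^sub>m) - \<phi>(t)\<^sup>m|\<close>. Away from \<open>0\<close> one has
  \<open>|\<phi>| \<le> exp(-c)\<close> since the span is maximal. Near \<open>0\<close>, \<open>|\<phi>(t)| \<le> exp(-c |t|\<^sup>\<alpha> h(1/|t|))\<close>,
  \<open>|exp(i t \<kappa>\<^sub>m) - 1| \<le> 2 |t \<kappa>\<^sub>m|\<^sup>\<eta>\<close> and \<open>|1 - \<phi>(t)\<^sup>m| \<le> C m |t|\<^sup>\<alpha> h(1/|t|)\<close>; for \<open>|t|\<close> below \<open>n\<close> to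
  the power \<open>-(1 + 1/\<alpha>)\<close>, where \<open>h(1/|t|)\<close> is not controlled by \<open>M\<close>, the trivial bound \<open>2 m\<close> suffices.

  The bounds on \<open>\<phi>\<close> come from truncated moments: \<open>|\<phi>(t)| = E cos(t X - \<theta>)\<close> gives the lower bound on
  \<open>1 - |\<phi>|\<close> in terms of \<open>E[X\<^sup>2; |X| \<le> 1/|t|]\<close>, and all moments are compared with \<open>h\<close> by dyadic induction,
  using only \<open>h(2x)/h(x) \<rightarrow> 1\<close>.
\<close>

subsection \<open>Dyadic comparison\<close>

text \<open>The two factors treat h differently. The first must have the exact order
  \<open>1 / b m\<close>, slowly varying part included, so the exponent m |t|^\<alpha> h(1/|t|) is
  compared with h(b_m) through \<open>b m powr \<alpha> = m * h (b m)\<close> and a Potter-type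
  bound. The second may lose: h is replaced by a positive lower bound, available from the liminf
  assumption, so that the integrals in t become pure powers of n - m, and writing b_n = L(n)
  n^(1/\<alpha>) leaves the factor L(n) of the claim. Rotating by \<theta> = arg \<phi>(t) avoids
  any expansion of \<phi>, but it shifts X by the uncontrolled amount \<theta>/t; hence the
  truncated second moment has to be bounded below uniformly over all centres, for which two atoms of
  the law suffice. The threshold on n guarantees that n^(1+1/\<alpha>) exceeds 1/\<epsilon>, so that
  the supremum M is over a nonempty range. The cutoff at the reciprocal of n^(1+1/\<alpha>) costs a
  multiple of m n^(-(1+1/\<alpha>)), which the factor n^(1/\<alpha>) turns into a multiple of m/n:
  this is the summand 1 in 1 + M.\<close>

lemma dyadic_comparison_upward:
  fixes F r :: "real \<Rightarrow> real"
  assumes x0: "x0 > 0" and q: "q > 1" and C: "C \<ge> 0" and D: "D \<ge> 0"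
    and step: "\<And>x. x \<ge> x0 \<Longrightarrow> F (2 * x) \<le> F x + C * r x"
    and grow: "\<And>x. x \<ge> x0 \<Longrightarrow> q * r x \<le> r (2 * x)"
    and nonneg: "\<And>x. x \<ge> x0 \<Longrightarrow> 0 \<le> r x"
    and base: "\<And>x. x0 \<le> x \<Longrightarrow> x \<le> 2 * x0 \<Longrightarrow> F x \<le> D * r x"
    and x: "x \<ge> x0"
  shows "F x \<le> (D + C / (q - 1)) * r x"
proof -
  \<comment> \<open>C/(q-1) solves \<open>E + C = E * q\<close>, and adding D covers the first block
    [x0, 2 x0] without spoiling \<open>E + C \<le> E * q\<close>. The bound with constant E then
    passes from one dyadic block to the next.\<close>
  define E where "E = D + C / (q - 1)"
  have ED: "E \<ge> D" using q C by (simp add: E_def)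
  have Eq: "E + C \<le> E * q"
  proof -
    have "C / (q - 1) * (q - 1) = C" using q by simp
    moreover have "D * (q - 1) \<ge> 0" using q D by simp
    ultimately have "E * (q - 1) \<ge> C" by (simp add: E_def distrib_right)
    then show ?thesis by (simp add: algebra_simps)
  qed
  have "\<forall>x. x0 \<le> x \<and> x \<le> 2 ^ Suc n * x0 \<longrightarrow> F x \<le> E * r x" for n
  proof (induction n)
    case 0
    have "F x \<le> E * r x" if "x0 \<le> x" "x \<le> 2 * x0" for x
      using base[OF that] mult_right_mono[OF ED nonneg[OF that(1)]] by linarith
    then show ?case by simp
  next
    case (Suc n)
    show ?case
    proof (intro allI impI)
      fix x assume x: "x0 \<le> x \<and> x \<le> 2 ^ Suc (Suc n) * x0"
      show "F x \<le> E * r x"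
      proof (cases "x \<le> 2 * x0")
        case True
        then show ?thesis
          using x base[of x] mult_right_mono[OF ED nonneg[of x]] by linarith
      next
        case False
        define y where "y = x / 2"
        have y: "x0 \<le> y" "y \<le> 2 ^ Suc n * x0" "x = 2 * y"
          using False x by (auto simp: y_def)
        have "F x \<le> F y + C * r y" using step[OF y(1)] y(3) by simp
        also have "\<dots> \<le> (E + C) * r y" using Suc.IH y by (simp add: distrib_right)
        also have "\<dots> \<le> E * q * r y" using Eq nonneg[OF y(1)] by (rule mult_right_mono)
        also have "\<dots> = E * (q * r y)" by simp
        also have "\<dots> \<le> E * r x"
          using grow[OF y(1)] y(3) ED D by (intro mult_left_mono) auto
        finally show ?thesis .
      qed
    qed
  qed
  moreover obtain n where "x / x0 < 2 ^ n" using real_arch_pow[of 2 "x / x0"] by auto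
  then have "x \<le> 2 ^ Suc n * x0" using x x0 by (simp add: field_simps)
  ultimately show ?thesis using x unfolding E_def by blast
qed

text \<open>With \<open>E = C / (1 - q)\<close>, which satisfies \<open>C - E = - E * q\<close>, the
  difference \<open>F - E * r\<close> does not decrease under doubling, and along the doubled points
  it stays below F, which tends to 0. The information comes from infinity instead of from a first
  block.\<close>

lemma dyadic_comparison_downward:
  fixes F r :: "real \<Rightarrow> real"
  assumes x0: "x0 > 0" and q: "q < 1" and C: "C \<ge> 0"
    and step: "\<And>x. x \<ge> x0 \<Longrightarrow> F x \<le> F (2 * x) + C * r x"
    and decay: "\<And>x. x \<ge> x0 \<Longrightarrow> r (2 * x) \<le> q * r x"
    and nonneg: "\<And>x. x \<ge> x0 \<Longrightarrow> 0 \<le> r x"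
    and lim: "(F \<longlongrightarrow> 0) at_top"
    and x: "x \<ge> x0"
  shows "F x \<le> C / (1 - q) * r x"
proof -
  define E where "E = C / (1 - q)"
  have E0: "E \<ge> 0" and Eq: "C - E = - E * q"
    using q C by (auto simp: E_def field_simps)
  have "F x - E * r x \<le> F (2 ^ n * x) - E * r (2 ^ n * x)" for n
  proof (induction n)
    case (Suc n)
    define y where "y = 2 ^ n * x"
    have "1 * x \<le> 2 ^ n * x" using x x0 by (intro mult_right_mono) auto
    then have y: "y \<ge> x0" using x by (simp add: y_def)
    have "F y - E * r y \<le> F (2 * y) + (C - E) * r y"
      using step[OF y] by (simp add: algebra_simps)
    also have "\<dots> = F (2 * y) - E * (q * r y)" by (simp add: Eq)
    also have "\<dots> \<le> F (2 * y) - E * r (2 * y)"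
      using decay[OF y] E0 by (simp add: mult_left_mono)
    finally show ?case using Suc by (simp add: y_def mult.assoc)
  qed simp
  moreover have "E * r (2 ^ n * x) \<ge> 0" for n :: nat
  proof -
    have "1 * x \<le> 2 ^ n * x" using x x0 by (intro mult_right_mono) auto
    then show ?thesis using x E0 by (intro mult_nonneg_nonneg nonneg) auto
  qed
  ultimately have le: "F x - E * r x \<le> F (2 ^ n * x)" for n
    by (smt (verit))
  have "filterlim (\<lambda>n. x * 2 ^ n :: real) at_top sequentially"
  proof (rule filterlim_at_top_mono)
    show "filterlim (\<lambda>n. x * real n) at_top sequentially"
      using x x0 by (intro filterlim_tendsto_pos_mult_at_top[OF tendsto_const _ filterlim_real_sequentially]) auto
    show "\<forall>\<^sub>F n in sequentially. x * real n \<le> x * 2 ^ n"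
      using x x0 by (intro always_eventually allI mult_left_mono less_imp_le of_nat_less_two_power) auto
  qed
  then have "(\<lambda>n. F (x * 2 ^ n)) \<longlonglongrightarrow> 0"
    by (rule filterlim_compose[OF lim])
  then have "F x - E * r x \<le> 0"
    by (rule LIMSEQ_le_const) (use le in \<open>auto simp: mult.commute\<close>)
  then show ?thesis by (simp add: E_def)
qed

text \<open>Full doublings cost nothing, so the factor c is paid only once, on the last incomplete
  step up to y, however far apart x and y are.\<close>

lemma dyadic_quasi_decreasing:
  fixes r :: "real \<Rightarrow> real"
  assumes x0: "x0 > 0"
    and step: "\<And>x. x \<ge> x0 \<Longrightarrow> r (2 * x) \<le> r x"
    and loc: "\<And>x y. x \<ge> x0 \<Longrightarrow> x \<le> y \<Longrightarrow> y \<le> 2 * x \<Longrightarrow> c * r y \<le> r x"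
    and xy: "x0 \<le> x" "x \<le> y"
  shows "c * r y \<le> r x"
proof -
  have "\<forall>x. x0 \<le> x \<and> x \<le> y \<and> y \<le> 2 ^ Suc n * x \<longrightarrow> c * r y \<le> r x" for n
  proof (induction n)
    case 0
    then show ?case using loc by simp
  next
    case (Suc n)
    show ?case
    proof (intro allI impI)
      fix x assume x: "x0 \<le> x \<and> x \<le> y \<and> y \<le> 2 ^ Suc (Suc n) * x"
      show "c * r y \<le> r x"
      proof (cases "y \<le> 2 * x")
        case True
        then show ?thesis using loc x by blast
      next
        case False
        then have "c * r y \<le> r (2 * x)"
          using x x0 by (intro Suc.IH[rule_format]) auto
        then show ?thesis using step[of x] x by simp
      qed
    qed
  qed
  moreover obtain n where "y / x < 2 ^ n" using real_arch_pow[of 2 "y / x"] by auto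
  then have "y \<le> 2 ^ Suc n * x" using xy x0 by (simp add: field_simps)
  ultimately show ?thesis using xy by blast
qed

subsection \<open>Stretched exponentials\<close>

lemma integrable_inverse_one_plus_square: "integrable lborel (\<lambda>x::real. inverse (1 + x\<^sup>2))"
  using integrable_inverse_1_plus_square by (simp add: set_integrable_def)

lemma powr_stretched_exp_bounded:
  fixes s q :: real
  assumes s: "s > 0" and q: "q > 0"
  obtains B where "\<And>u. u \<ge> 0 \<Longrightarrow> u powr s * exp (- (u powr q)) \<le> B"
proof -
  \<comment> \<open>In terms of v = u^q the power is v^(s/q). For v \<ge> 1 it is dominated by the
    integer power v^k, and v^k/k! is one term of the series of exp v.\<close>
  obtain k :: nat where k: "s / q \<le> real k" using real_arch_simple by blast
  have "u powr s * exp (- (u powr q)) \<le> 1 + fact k" if u: "u \<ge> 0" for u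
  proof (cases "u \<le> 1")
    case True
    have "u powr s \<le> 1" using True u s by (simp add: powr_le1)
    then have "u powr s * exp (- (u powr q)) \<le> 1 * 1" by (intro mult_mono) auto
    then show ?thesis by (simp add: add_increasing2)
  next
    case False
    define v where "v = u powr q"
    have v: "v \<ge> 1" using False q by (simp add: v_def ge_one_powr_ge_zero)
    have "u powr s = v powr (s / q)" using q by (simp add: v_def powr_powr)
    also have "\<dots> \<le> v powr real k" using v k by (intro powr_mono) auto
    also have "\<dots> = v ^ k" using v by (simp add: powr_realpow)
    also have "\<dots> \<le> fact k * exp v"
    proof -
      have "v ^ k /\<^sub>R fact k \<le> exp v"
        unfolding exp_def using sum_le_suminf[OF summable_exp_generic[of v], of "{k}"] v by simp
      then show ?thesis by (simp add: field_simps)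
    qed
    finally have "u powr s * exp (- v) \<le> fact k * exp v * exp (- v)" by simp
    then show ?thesis unfolding v_def by (simp add: mult.assoc exp_minus_inverse)
  qed
  then show ?thesis by (rule that)
qed

text \<open>Two claims are made because \<open>0 powr 0 = 0\<close>: the second integrand is not
  literally the first one with p = 0.\<close>

lemma integrable_powr_stretched_exp:
  fixes p q :: real
  assumes p: "p \<ge> 0" and q: "q > 0"
  shows "integrable lborel (\<lambda>t. \<bar>t\<bar> powr p * exp (- (\<bar>t\<bar> powr q)))" (is ?th1)
    and "integrable lborel (\<lambda>t. exp (- (\<bar>t\<bar> powr q)))" (is ?th2)
proof -
  \<comment> \<open>The exponent p + 1 stands in for p because p may be 0, while the boundedness
    lemma asks for a positive exponent. Together with p + 2 it yields a majorant proportional to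
    1/(1 + t^2).\<close>
  obtain B0 where B0: "u powr (p + 1) * exp (- (u powr q)) \<le> B0" if "u \<ge> 0" for u
    using powr_stretched_exp_bounded[of "p + 1" q] p q by auto
  obtain B2 where B2: "u powr (p + 2) * exp (- (u powr q)) \<le> B2" if "u \<ge> 0" for u
    using powr_stretched_exp_bounded[of "p + 2" q] p q by auto
  obtain B1 where B1: "u powr 2 * exp (- (u powr q)) \<le> B1" if "u \<ge> 0" for u
    using powr_stretched_exp_bounded[of 2 q] q by auto
  have b1: "exp (- (\<bar>t\<bar> powr q)) \<le> (1 + B1) * inverse (1 + t\<^sup>2)" for t
  proof -
    have "(1 + t\<^sup>2) * exp (- (\<bar>t\<bar> powr q)) \<le> 1 + B1"
      using B1[of "\<bar>t\<bar>"] by (simp add: distrib_right add_mono)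
    then show ?thesis
      by (simp add: divide_simps add_pos_nonneg mult.commute)
  qed
  have b2: "\<bar>t\<bar> powr p * exp (- (\<bar>t\<bar> powr q)) \<le> (1 + B0 + B2) * inverse (1 + t\<^sup>2)" for t
  proof -
    have t2: "t\<^sup>2 * \<bar>t\<bar> powr p = \<bar>t\<bar> powr (p + 2)"
      by (cases "t = 0") (simp_all add: powr_add)
    have "\<bar>t\<bar> powr p \<le> 1 + \<bar>t\<bar> powr (p + 1)"
    proof (cases "\<bar>t\<bar> \<le> 1")
      case True
      then have "\<bar>t\<bar> powr p \<le> 1" using p by (intro powr_le1) auto
      then show ?thesis by (simp add: add_increasing2)
    next
      case False
      then have "\<bar>t\<bar> powr p \<le> \<bar>t\<bar> powr (p + 1)" by (intro powr_mono) auto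
      then show ?thesis by simp
    qed
    then have "\<bar>t\<bar> powr p * exp (- (\<bar>t\<bar> powr q)) \<le> (1 + \<bar>t\<bar> powr (p + 1)) * exp (- (\<bar>t\<bar> powr q))"
      by (intro mult_right_mono) auto
    also have "\<dots> \<le> 1 + B0"
      using B0[of "\<bar>t\<bar>"] by (simp add: distrib_right add_mono)
    finally have "(1 + t\<^sup>2) * (\<bar>t\<bar> powr p * exp (- (\<bar>t\<bar> powr q))) \<le> 1 + B0 + B2"
      using B2[of "\<bar>t\<bar>"] by (simp add: distrib_right mult.assoc[symmetric] t2)
    then show ?thesis
      by (simp add: divide_simps add_pos_nonneg mult.commute)
  qed
  have int: "integrable lborel (\<lambda>t::real. D * inverse (1 + t\<^sup>2))" for D
    by (intro integrable_mult_right integrable_inverse_one_plus_square)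
  show ?th1
  proof (rule Bochner_Integration.integrable_bound[OF int[of "1 + B0 + B2"]])
    show "AE t in lborel. norm (\<bar>t\<bar> powr p * exp (- (\<bar>t\<bar> powr q)))
        \<le> norm ((1 + B0 + B2) * inverse (1 + t\<^sup>2))"
      by (intro AE_I2) (use b2 in \<open>auto intro: order_trans[OF _ abs_ge_self]\<close>)
  qed measurable
  show ?th2
  proof (rule Bochner_Integration.integrable_bound[OF int[of "1 + B1"]])
    show "AE t in lborel. norm (exp (- (\<bar>t\<bar> powr q)))
        \<le> norm ((1 + B1) * inverse (1 + t\<^sup>2))"
      by (intro AE_I2) (use b1 in \<open>auto intro: order_trans[OF _ abs_ge_self]\<close>)
  qed measurable
qed

lemma stretched_exp_scaled:
  fixes q k :: real
  assumes q: "q > 0" and k: "k > 0"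
  shows "integrable lborel (\<lambda>t. exp (- ((k * \<bar>t\<bar>) powr q)))"
    and "(\<integral>t. exp (- ((k * \<bar>t\<bar>) powr q)) \<partial>lborel) = (\<integral>t. exp (- (\<bar>t\<bar> powr q)) \<partial>lborel) / k"
  using lborel_integrable_real_affine[OF integrable_powr_stretched_exp(2)[OF order_refl q], of k 0]
    lborel_integral_real_affine[of k "\<lambda>t. exp (- (\<bar>t\<bar> powr q))" 0] k
  by (auto simp: abs_mult)

text \<open>A change of variables by the factor k^(1/q). With k proportional to n - m and q =
  \<alpha>, the exponent -(p+1)/q is the source of the powers (\<eta>+1)/\<alpha> and 1 + 1/\<alpha>
  of 1 - m/n in the denominators of the theorem.\<close>

lemma powr_stretched_exp_scaled:
  fixes p q k :: real
  assumes p: "p \<ge> 0" and q: "q > 0" and k: "k > 0"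
  shows "integrable lborel (\<lambda>t. \<bar>t\<bar> powr p * exp (- (k * \<bar>t\<bar> powr q)))" (is ?int)
    and "(\<integral>t. \<bar>t\<bar> powr p * exp (- (k * \<bar>t\<bar> powr q)) \<partial>lborel)
      = (\<integral>t. \<bar>t\<bar> powr p * exp (- (\<bar>t\<bar> powr q)) \<partial>lborel) * k powr (- ((p + 1) / q))" (is ?eq)
proof -
  define s where "s = k powr (1 / q)"
  have s: "s > 0" and sq: "s powr q = k" and sp: "s powr p * s = k powr ((p + 1) / q)"
    using k q by (auto simp: s_def powr_powr powr_add[symmetric] add_divide_distrib)
  let ?g = "\<lambda>t. \<bar>t\<bar> powr p * exp (- (\<bar>t\<bar> powr q))"
  have g: "?g (0 + s * t) = s powr p * (\<bar>t\<bar> powr p * exp (- (k * \<bar>t\<bar> powr q)))" for t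
    using s by (simp add: abs_mult powr_mult sq)
  have "integrable lborel (\<lambda>t. s powr p * (\<bar>t\<bar> powr p * exp (- (k * \<bar>t\<bar> powr q))))"
    using lborel_integrable_real_affine[OF integrable_powr_stretched_exp(1)[OF p q], of s 0] s
    unfolding g by simp
  then show ?int using s by simp
  have "(\<integral>t. ?g t \<partial>lborel) = s *\<^sub>R (\<integral>t. ?g (0 + s * t) \<partial>lborel)"
    using lborel_integral_real_affine[of s ?g 0] s by simp
  also have "\<dots> = (s powr p * s) * (\<integral>t. \<bar>t\<bar> powr p * exp (- (k * \<bar>t\<bar> powr q)) \<partial>lborel)"
    unfolding g by simp
  finally show ?eq
    using k unfolding sp by (simp add: powr_minus field_simps)
qed

text \<open>The range is dictated by arguments t y - \<theta> with |t y| \<le> 1 and |\<theta>|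
  \<le> pi. It stays below 3 pi/2, so cos is nonpositive once |u| > 2, and there the constant 25
  only has to dominate u^2; for smaller u the Taylor polynomial of order 3 gives more than
  enough.\<close>

lemma one_minus_cos_ge:
  fixes u :: real
  assumes "\<bar>u\<bar> \<le> pi + 1"
  shows "u\<^sup>2 / 25 \<le> 1 - cos u"
proof (cases "\<bar>u\<bar> \<le> 2")
  case True
  have "Re (iexp u - (\<Sum>k\<le>3. (\<i> * u)^k / fact k)) \<le> \<bar>u\<bar>^4 / fact 4"
    using order_trans[OF complex_Re_le_cmod iexp_approx1[of u 3]] by simp
  moreover have "Re (iexp u - (\<Sum>k\<le>3. (\<i> * u)^k / fact k)) = cos u - 1 + u\<^sup>2 / 2"
    by (simp add: numeral_eq_Suc Re_exp Im_exp fact_reduce)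
  moreover have "\<bar>u\<bar>^4 / fact 4 \<le> u\<^sup>2 / 6"
  proof -
    have "u\<^sup>2 \<le> 4" using True abs_le_square_iff[of u 2] by simp
    then have "u\<^sup>2 * u\<^sup>2 \<le> 4 * u\<^sup>2" by (intro mult_right_mono) auto
    then show ?thesis by (simp add: fact_numeral power4_eq_xxxx power2_eq_square)
  qed
  ultimately have "cos u - 1 + u\<^sup>2 / 2 \<le> u\<^sup>2 / 6" by linarith
  then show ?thesis using zero_le_power2[of u] by linarith
next
  case False
  have "cos \<bar>u\<bar> \<le> 0"
  proof -
    have "\<bar>u\<bar> \<ge> pi / 2" "\<bar>u\<bar> \<le> 3 * pi / 2"
      using False assms pi_less_4 pi_gt3 by auto
    then have "cos (\<bar>u\<bar> - pi) \<ge> 0" by (intro cos_ge_zero) auto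
    then show ?thesis by (simp add: cos_diff)
  qed
  then have "cos u \<le> 0" by simp
  moreover have "u\<^sup>2 \<le> 25"
    using assms pi_less_4 abs_le_square_iff[of u 5] by simp
  ultimately show ?thesis by simp
qed

subsection \<open>Characteristic functions and truncated moments\<close>

lemma integral_iexp_int_period:
  fixes k :: int
  shows "(CLBINT t. indicator {-pi..pi} t *\<^sub>R iexp (t * of_int k)) = (if k = 0 then 2 * pi else 0)"
proof (cases "k = 0")
  case True
  have "(CLBINT t. indicator {-pi..pi} t *\<^sub>R (1::complex)) = of_real (measure lborel {-pi..pi})"
    by (subst has_bochner_integral_integral_eq[OF has_bochner_integral_indicator])
       (auto simp: scaleR_conv_of_real)
  then show ?thesis using True by simp
next
  case False
  define F where "F = (\<lambda>t::real. iexp (t * of_int k) / (\<i> * of_int k))"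
  have "(CLBINT t. indicator {-pi..pi} t *\<^sub>R iexp (t * of_int k)) = F pi - F (- pi)"
  proof (rule integral_FTC_Icc)
    show "(F has_vector_derivative iexp (t * of_int k)) (at t within {-pi..pi})" for t
      unfolding F_def using False
      by (auto intro!: derivative_eq_intros has_vector_derivative_real_field simp: field_simps)
    show "continuous_on {-pi..pi} (\<lambda>t. iexp (t * of_int k))"
      by (intro continuous_intros)
  qed simp
  also have "F pi - F (- pi) = 0"
  proof -
    have "iexp (pi * of_int k) = iexp (- pi * of_int k)"
      unfolding exp_eq by (intro exI[of _ k]) (simp add: algebra_simps)
    then show ?thesis by (simp add: F_def)
  qed
  finally show ?thesis using False by simp
qed

context real_distribution
begin

text \<open>Exchanging expectation and integral leaves the average of
  \<open>iexp (t * (x - y))\<close> over a period, which is 1 at x = y and 0 at every other point of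
  the lattice through y.\<close>

lemma lattice_inversion:
  assumes lat: "AE x in M. x - y \<in> \<int>"
  shows "integrable lborel (\<lambda>t. indicator {-pi..pi} t *\<^sub>R (iexp (- (t * y)) * char M t))"
    and "complex_of_real (measure M {y}) =
      (CLBINT t. indicator {-pi..pi} t *\<^sub>R (iexp (- (t * y)) * char M t)) / (2 * pi)"
proof -
  interpret P: pair_sigma_finite lborel M ..
  let ?f = "\<lambda>t x. indicator {-pi..pi} t *\<^sub>R iexp (t * (x - y))"
  have int: "integrable (lborel \<Otimes>\<^sub>M M) (\<lambda>(t, x). ?f t x)"
  proof (rule integrableI_bounded_set[where A = "{-pi..pi} \<times> space M" and B = 1])
    show "emeasure (lborel \<Otimes>\<^sub>M M) ({-pi..pi} \<times> space M) < \<infinity>"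
      using emeasure_space_1 by (subst emeasure_pair_measure_Times) (auto simp: ennreal_mult_less_top)
    show "AE z in lborel \<Otimes>\<^sub>M M. z \<notin> {-pi..pi} \<times> space M \<longrightarrow> (case z of (t, x) \<Rightarrow> ?f t x) = 0"
      by (intro AE_I2) (auto split: split_indicator split_indicator_asm)
    show "AE z\<in>{-pi..pi} \<times> space M in lborel \<Otimes>\<^sub>M M. norm (case z of (t, x) \<Rightarrow> ?f t x) \<le> 1"
      by (intro AE_I2) (auto split: split_indicator)
  qed auto
  have inner: "(CLINT x|M. ?f t x) = indicator {-pi..pi} t *\<^sub>R (iexp (- (t * y)) * char M t)" for t
  proof -
    have "(CLINT x|M. ?f t x)
        = (CLINT x|M. (indicator {-pi..pi} t *\<^sub>R iexp (- (t * y))) * iexp (t * x))"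
      by (intro Bochner_Integration.integral_cong refl)
         (simp add: exp_add[symmetric] algebra_simps)
    then show ?thesis by (simp add: char_def)
  qed
  show "integrable lborel (\<lambda>t. indicator {-pi..pi} t *\<^sub>R (iexp (- (t * y)) * char M t))"
    using P.integrable_fst'[OF int] unfolding prod.case inner .
  have "(CLBINT t. indicator {-pi..pi} t *\<^sub>R (iexp (- (t * y)) * char M t))
      = (CLBINT t. (CLINT x|M. ?f t x))"
    unfolding inner ..
  also have "\<dots> = (CLINT x|M. (CLBINT t. ?f t x))"
    using P.Fubini_integral[OF int] by simp
  also have "\<dots> = (CLINT x|M. indicator {y} x *\<^sub>R complex_of_real (2 * pi))"
  proof (rule integral_cong_AE)
    show "AE x in M. (CLBINT t. ?f t x) = indicator {y} x *\<^sub>R complex_of_real (2 * pi)"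
      using lat
    proof eventually_elim
      case (elim x)
      then obtain k where k: "x - y = of_int k" by (elim Ints_cases)
      show ?case using integral_iexp_int_period[of k] k by (auto split: split_indicator)
    qed
  qed measurable
  also have "\<dots> = 2 * pi * of_real (measure M {y})"
    by (subst has_bochner_integral_integral_eq[OF has_bochner_integral_indicator])
       (auto simp: scaleR_conv_of_real emeasure_finite less_top[symmetric])
  finally show "complex_of_real (measure M {y}) =
      (CLBINT t. indicator {-pi..pi} t *\<^sub>R (iexp (- (t * y)) * char M t)) / (2 * pi)"
    by simp
qed

text \<open>Rotating \<phi>(t) by its argument turns the modulus into the expectation of a real
  variable. This serves both the quantitative bound near 0 and the characterization of the case of
  modulus 1.\<close>

lemma norm_char_eq_integral_cos:
  obtains \<theta> where "\<bar>\<theta>\<bar> \<le> pi" and "norm (char M t) = (\<integral>x. cos (t * x - \<theta>) \<partial>M)"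
proof -
  define \<theta> where "\<theta> = Arg (char M t)"
  have th: "\<bar>\<theta>\<bar> \<le> pi" using Arg_bounded[of "char M t"] by (auto simp: \<theta>_def)
  have "char M t = of_real (norm (char M t)) * iexp \<theta>"
    using Arg_eq[of "char M t"] by (cases "char M t = 0") (auto simp: \<theta>_def)
  then have "of_real (norm (char M t)) = iexp (- \<theta>) * char M t"
    by (simp add: exp_minus field_simps)
  also have "\<dots> = (CLINT x|M. iexp (- \<theta>) * iexp (t * x))"
    by (simp add: char_def)
  also have "\<dots> = (CLINT x|M. iexp (t * x - \<theta>))"
    by (intro Bochner_Integration.integral_cong refl) (simp add: exp_add[symmetric] algebra_simps)
  finally have "norm (char M t) = Re (CLINT x|M. iexp (t * x - \<theta>))"
    by (metis Re_complex_of_real)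
  also have "\<dots> = (\<integral>x. Re (iexp (t * x - \<theta>)) \<partial>M)"
    by (intro integral_Re[symmetric] integrable_iexp) auto
  finally show ?thesis
    using th that by (simp add: Re_exp)
qed

lemma integrable_cos [simp]: "integrable M (\<lambda>x. cos (t * x - \<theta>))"
  by (rule integrable_const_bound[where B = 1]) auto

lemma integrable_truncated:
  assumes [measurable]: "f \<in> borel_measurable borel" and "\<And>y. \<bar>y\<bar> \<le> x \<Longrightarrow> \<bar>f y\<bar> \<le> B"
  shows "integrable M (\<lambda>y. indicator {-x..x} y * f y :: real)"
  using assms(2)
  by (intro integrable_const_bound[where B = "max B 0"])
     (auto split: split_indicator simp: abs_le_iff le_max_iff_disj)

lemma integrable_truncated_square: "integrable M (\<lambda>y. indicator {-x..x} y * (y - a)\<^sup>2 :: real)"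
proof (rule integrable_truncated)
  fix y :: real assume "\<bar>y\<bar> \<le> x"
  then have "\<bar>y - a\<bar> \<le> \<bar>x + \<bar>a\<bar>\<bar>" by linarith
  then show "\<bar>(y - a)\<^sup>2\<bar> \<le> (x + \<bar>a\<bar>)\<^sup>2"
    unfolding abs_le_square_iff by simp
qed measurable

section \<open>Truncated second moments and the size of the characteristic function\<close>

definition trunc_moment2 :: "real \<Rightarrow> real"
  where "trunc_moment2 x = (\<integral>y. indicator {-x..x} y * y\<^sup>2 \<partial>M)"

lemma trunc_moment2_mono: "x \<le> y \<Longrightarrow> trunc_moment2 x \<le> trunc_moment2 y"
  unfolding trunc_moment2_def
  using integrable_truncated_square[of _ 0]
  by (intro integral_mono) (auto split: split_indicator)

lemma ex_symmetric_interval_prob_ge: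
  assumes "p < 1"
  obtains K where "K > 0" and "p \<le> measure M {-K..K}"
proof -
  have "(\<lambda>n. measure M {- real n..real n}) \<longlonglongrightarrow> measure M (\<Union>n. {- real n..real n})"
    by (intro finite_Lim_measure_incseq) (auto simp: incseq_def)
  moreover have "(\<Union>n. {- real n..real n}) = UNIV"
  proof -
    have "\<exists>n. x \<in> {- real n..real n}" for x
      using real_arch_simple[of "\<bar>x\<bar>"] by (auto simp: abs_le_iff minus_le_iff)
    then show ?thesis by auto
  qed
  ultimately have "(\<lambda>n. measure M {- real n..real n}) \<longlonglongrightarrow> 1"
    using prob_space by simp
  then have "\<forall>\<^sub>F n in sequentially. p < measure M {- real n..real n}"
    using assms by (rule order_tendstoD)
  then have "\<forall>\<^sub>F n in sequentially. p < measure M {- real n..real n} \<and> 0 < n"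
    using eventually_gt_at_top[of 0] by eventually_elim simp
  then obtain n where "p < measure M {- real n..real n}" "0 < n"
    by (auto simp: eventually_sequentially)
  then show ?thesis using that[of "real n"] by auto
qed

text \<open>The centre a will be \<theta>/t, over which there is no control as t tends to 0, so c
  must not depend on it. If a is far out, the interval [-K, K] with at least half of the mass makes
  the centred moment at least a^2/8. If a is near, a^2 \<le> 4 K^2, and K^2 is absorbed by the
  positive amount \<delta> that the two atoms contribute for any centre.\<close>

lemma trunc_moment2_le_centered:
  assumes uv: "u \<noteq> v" "measure M {u} > 0" "measure M {v} > 0"
  obtains c x0 where "c > 0" "x0 > 0"
    "\<And>x a. x \<ge> x0 \<Longrightarrow> c * trunc_moment2 x \<le> (\<integral>y. indicator {-x..x} y * (y - a)\<^sup>2 \<partial>M)"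
proof -
  obtain K where K: "K > 0" "1/2 \<le> measure M {-K..K}"
    using ex_symmetric_interval_prob_ge[of "1/2"] by auto
  define x0 where "x0 = max K (max \<bar>u\<bar> \<bar>v\<bar>)"
  define p where "p = min (measure M {u}) (measure M {v})"
  define \<delta> where "\<delta> = p * (u - v)\<^sup>2 / 2"
  have p: "p > 0" and \<delta>: "\<delta> > 0" using uv by (auto simp: p_def \<delta>_def)
  \<comment> \<open>With E the centred moment, y^2 \<le> 2 (y - a)^2 + 2 a^2 and a^2 \<le> 8 E + 4
    K^2 give 18 E + 8 K^2, and the last term is at most (8 K^2/\<delta>) E because \<delta> \<le>
    E.\<close>
  define D where "D = 18 + 8 * K\<^sup>2 / \<delta>"
  have D: "D > 0" using \<delta> by (auto simp: D_def intro!: add_pos_nonneg)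
  have main: "trunc_moment2 x \<le> D * (\<integral>y. indicator {-x..x} y * (y - a)\<^sup>2 \<partial>M)"
    (is "_ \<le> D * ?E") if x: "x \<ge> x0" for x a
  proof -
    have uvx: "\<bar>u\<bar> \<le> x" "\<bar>v\<bar> \<le> x" and Kx: "K \<le> x" using x by (auto simp: x0_def)
    have 1: "\<delta> \<le> ?E"
    proof -
      have "\<delta> \<le> p * ((u - a)\<^sup>2 + (v - a)\<^sup>2)"
      proof -
        have "(u - v)\<^sup>2 / 2 \<le> (u - a)\<^sup>2 + (v - a)\<^sup>2"
        proof -
          have "2 * ((u - a)\<^sup>2 + (v - a)\<^sup>2) = (u - v)\<^sup>2 + (u + v - 2 * a)\<^sup>2"
            by (simp add: power2_eq_square algebra_simps)
          then have "(u - v)\<^sup>2 \<le> 2 * ((u - a)\<^sup>2 + (v - a)\<^sup>2)" by simp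
          then show ?thesis by simp
        qed
        then have "p * ((u - v)\<^sup>2 / 2) \<le> p * ((u - a)\<^sup>2 + (v - a)\<^sup>2)"
          using p by (intro mult_left_mono) auto
        then show ?thesis by (simp add: \<delta>_def)
      qed
      also have "\<dots> \<le> measure M {u} * (u - a)\<^sup>2 + measure M {v} * (v - a)\<^sup>2"
        unfolding distrib_left by (intro add_mono mult_right_mono) (auto simp: p_def)
      also have "\<dots> = (\<integral>y. indicator {u} y * (u - a)\<^sup>2 + indicator {v} y * (v - a)\<^sup>2 \<partial>M)"
        by (subst Bochner_Integration.integral_add) (auto simp: emeasure_finite less_top[symmetric])
      also have "\<dots> \<le> ?E"
        using uv(1) uvx integrable_truncated_square[of x a]
        by (intro integral_mono)
           (auto split: split_indicator simp: emeasure_finite less_top[symmetric] abs_le_iff)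
      finally show ?thesis .
    qed
    have 2: "a\<^sup>2 \<le> 8 * ?E + 4 * K\<^sup>2"
    proof (cases "\<bar>a\<bar> \<le> 2 * K")
      case True
      then have "a\<^sup>2 \<le> 4 * K\<^sup>2" using K abs_le_square_iff[of a "2 * K"] by (simp add: power_mult_distrib)
      then show ?thesis using 1 \<delta> by linarith
    next
      case False
      have pt: "indicator {-K..K} y * (a\<^sup>2 / 4) \<le> indicator {-x..x} y * (y - a)\<^sup>2" for y
      proof (cases "y \<in> {-K..K}")
        case True
        then have "\<bar>y\<bar> \<le> K" by auto
        moreover have "\<bar>a / 2\<bar> = \<bar>a\<bar> / 2" by simp
        ultimately have "\<bar>a / 2\<bar> \<le> \<bar>y - a\<bar>" using False by linarith
        then have "(a / 2)\<^sup>2 \<le> (y - a)\<^sup>2" unfolding abs_le_square_iff .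
        then show ?thesis using True Kx by (auto simp: power_divide)
      qed auto
      have "1/2 * (a\<^sup>2 / 4) \<le> measure M {-K..K} * (a\<^sup>2 / 4)"
        using K by (intro mult_right_mono) auto
      also have "\<dots> = (\<integral>y. indicator {-K..K} y * (a\<^sup>2 / 4) \<partial>M)" by simp
      also have "\<dots> \<le> ?E"
        using pt integrable_truncated_square[of x a]
        by (intro integral_mono) (auto simp: emeasure_finite less_top[symmetric])
      finally show ?thesis using zero_le_power2[of K] by linarith
    qed
    have 3: "trunc_moment2 x \<le> 2 * ?E + 2 * a\<^sup>2"
    proof -
      have pt: "indicator {-x..x} y * y\<^sup>2 \<le> 2 * (indicator {-x..x} y * (y - a)\<^sup>2) + 2 * a\<^sup>2" for y
        using zero_le_power2[of "y - 2 * a"]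
        by (auto split: split_indicator simp: power2_eq_square algebra_simps)
      have "trunc_moment2 x \<le> (\<integral>y. 2 * (indicator {-x..x} y * (y - a)\<^sup>2) + 2 * a\<^sup>2 \<partial>M)"
        unfolding trunc_moment2_def
        using pt integrable_truncated_square[of x a] integrable_truncated_square[of x 0]
        by (intro integral_mono) auto
      also have "\<dots> = 2 * ?E + 2 * a\<^sup>2"
        using integrable_truncated_square[of x a] prob_space
        by (subst Bochner_Integration.integral_add) auto
      finally show ?thesis .
    qed
    have "trunc_moment2 x \<le> 18 * ?E + 8 * K\<^sup>2" using 2 3 by linarith
    also have "8 * K\<^sup>2 = 8 * K\<^sup>2 / \<delta> * \<delta>" using \<delta> by simp
    also have "\<dots> \<le> 8 * K\<^sup>2 / \<delta> * ?E" using 1 \<delta> by (intro mult_left_mono) auto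
    finally show ?thesis by (simp add: D_def distrib_right)
  qed
  show ?thesis
  proof (rule that[of "1 / D" x0])
    show "x0 > 0" using K by (simp add: x0_def less_max_iff_disj)
    show "1 / D * trunc_moment2 x \<le> (\<integral>y. indicator {-x..x} y * (y - a)\<^sup>2 \<partial>M)"
      if "x \<ge> x0" for x a
      using main[OF that, of a] D by (simp add: field_simps)
  qed (use D in auto)
qed

lemma norm_char_le_exp_trunc_moment2:
  assumes "u \<noteq> v" "measure M {u} > 0" "measure M {v} > 0"
  obtains c x0 where "c > 0" "x0 > 0"
    "\<And>t. t \<noteq> 0 \<Longrightarrow> \<bar>t\<bar> \<le> 1 / x0 \<Longrightarrow> norm (char M t) \<le> exp (- (c * t\<^sup>2 * trunc_moment2 (1 / \<bar>t\<bar>)))"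
proof -
  obtain c x0 where c: "c > 0" "x0 > 0"
    and low: "\<And>x a. x \<ge> x0 \<Longrightarrow> c * trunc_moment2 x \<le> (\<integral>y. indicator {-x..x} y * (y - a)\<^sup>2 \<partial>M)"
    using trunc_moment2_le_centered[OF assms] by blast
  have "norm (char M t) \<le> exp (- (c / 25 * t\<^sup>2 * trunc_moment2 (1 / \<bar>t\<bar>)))"
    if t: "t \<noteq> 0" "\<bar>t\<bar> \<le> 1 / x0" for t
  proof -
    define x where "x = 1 / \<bar>t\<bar>"
    have x: "x \<ge> x0" using t c by (simp add: x_def field_simps)
    obtain \<theta> where th: "\<bar>\<theta>\<bar> \<le> pi" and eq: "norm (char M t) = (\<integral>y. cos (t * y - \<theta>) \<partial>M)"
      by (rule norm_char_eq_integral_cos)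
    \<comment> \<open>Only |y| \<le> 1/|t| is exploited, where the argument of cos has modulus at
      most pi + 1; elsewhere 1 - cos is merely nonnegative. The rotation angle appears as the centre
      \<theta>/t.\<close>
    have pt: "t\<^sup>2 / 25 * (indicator {-x..x} y * (y - \<theta> / t)\<^sup>2) \<le> 1 - cos (t * y - \<theta>)" for y
    proof (cases "y \<in> {-x..x}")
      case True
      then have "\<bar>y\<bar> \<le> x" by auto
      then have "\<bar>t * y\<bar> \<le> 1" using t(1) by (simp add: x_def abs_mult field_simps)
      then have "(t * y - \<theta>)\<^sup>2 / 25 \<le> 1 - cos (t * y - \<theta>)"
        using th by (intro one_minus_cos_ge) linarith
      moreover have "t\<^sup>2 * (y - \<theta> / t)\<^sup>2 = (t * y - \<theta>)\<^sup>2"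
        using t(1) by (simp add: power_mult_distrib[symmetric] right_diff_distrib)
      ultimately show ?thesis using True by simp
    qed auto
    have "t\<^sup>2 / 25 * (c * trunc_moment2 x)
        \<le> t\<^sup>2 / 25 * (\<integral>y. indicator {-x..x} y * (y - \<theta> / t)\<^sup>2 \<partial>M)"
      using low[OF x] by (intro mult_left_mono) auto
    also have "\<dots> = (\<integral>y. t\<^sup>2 / 25 * (indicator {-x..x} y * (y - \<theta> / t)\<^sup>2) \<partial>M)"
      by simp
    also have "\<dots> \<le> (\<integral>y. 1 - cos (t * y - \<theta>) \<partial>M)"
      using pt integrable_truncated_square[of x "\<theta> / t"] by (intro integral_mono) auto
    also have "\<dots> = 1 - norm (char M t)"
      using prob_space by (simp add: eq)
    finally have "norm (char M t) \<le> 1 - c / 25 * t\<^sup>2 * trunc_moment2 x"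
      by (simp add: mult_ac)
    also have "\<dots> \<le> exp (- (c / 25 * t\<^sup>2 * trunc_moment2 x))"
      using exp_ge_add_one_self[of "- (c / 25 * t\<^sup>2 * trunc_moment2 x)"] by simp
    finally show ?thesis by (simp add: x_def)
  qed
  then show ?thesis using that[of "c / 25" x0] c by auto
qed

text \<open>The nonnegative variable 1 - cos(t X - \<theta>) then has mean zero, so t X - \<theta>
  is almost surely a multiple of 2 pi.\<close>

lemma norm_char_eq_1_imp_lattice:
  assumes t: "t \<noteq> 0" and eq1: "norm (char M t) = 1"
  obtains a where "AE x in M. x \<in> lattice_pts a (2 * pi / \<bar>t\<bar>)"
proof -
  obtain \<theta> where th: "norm (char M t) = (\<integral>y. cos (t * y - \<theta>) \<partial>M)"
    by (rule norm_char_eq_integral_cos)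
  have "(\<integral>y. 1 - cos (t * y - \<theta>) \<partial>M) = 0"
    using th eq1 prob_space by simp
  then have "AE y in M. 1 - cos (t * y - \<theta>) = 0"
    by (subst (asm) integral_nonneg_eq_0_iff_AE) auto
  then have "AE y in M. y \<in> lattice_pts (\<theta> / t) (2 * pi / \<bar>t\<bar>)"
  proof eventually_elim
    case (elim y)
    then obtain k :: int where k: "t * y - \<theta> = real_of_int k * 2 * pi"
      by (auto simp: cos_one_2pi_int)
    \<comment> \<open>The span is written with |t|, so a negative t reverses the sign of k.\<close>
    have "y = \<theta> / t + 2 * pi / \<bar>t\<bar> * of_int (if t > 0 then k else - k)"
      using k t by (auto simp: field_simps)
    then show ?case unfolding lattice_pts_def by blast
  qed
  then show ?thesis by (rule that)
qed

text \<open>A point with |\<phi>(t)| = 1 and 0 < |t| \<le> pi would put the law on a lattice of span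
  2 pi/|t| \<ge> 2, against the maximality of span 1. Compactness turns |\<phi>| < 1 into a uniform
  gap.\<close>

lemma norm_char_bounded_away:
  assumes span: "\<And>a d. d > 1 \<Longrightarrow> \<not> (AE x in M. x \<in> lattice_pts a d)" and e: "0 < e"
  obtains c where "c > 0" "\<And>t. e \<le> \<bar>t\<bar> \<Longrightarrow> \<bar>t\<bar> \<le> pi \<Longrightarrow> norm (char M t) \<le> exp (- c)"
proof -
  define K where "K = {t. e \<le> \<bar>t\<bar> \<and> \<bar>t\<bar> \<le> pi}"
  have less1: "norm (char M t) < 1" if "t \<in> K" for t
  proof (rule ccontr)
    assume "\<not> norm (char M t) < 1"
    then have "norm (char M t) = 1" using cmod_char_le_1[of t] by linarith
    moreover have t: "t \<noteq> 0" "\<bar>t\<bar> \<le> pi" using that e by (auto simp: K_def)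
    ultimately obtain a where "AE x in M. x \<in> lattice_pts a (2 * pi / \<bar>t\<bar>)"
      using norm_char_eq_1_imp_lattice by blast
    moreover have "2 * pi / \<bar>t\<bar> > 1" using t by (simp add: field_simps)
    ultimately show False using span by blast
  qed
  show ?thesis
  proof (cases "K = {}")
    case True
    then show ?thesis using that[of 1] by (auto simp: K_def)
  next
    case False
    have "compact K"
    proof -
      have "K = {-pi..pi} \<inter> {t. e \<le> \<bar>t\<bar>}" by (auto simp: K_def)
      moreover have "closed {t::real. e \<le> \<bar>t\<bar>}" by (intro closed_Collect_le continuous_intros)
      ultimately show ?thesis by (simp add: compact_Int_closed)
    qed
    moreover have "continuous_on K (\<lambda>t. norm (char M t))"
      by (intro continuous_at_imp_continuous_on ballI continuous_norm isCont_char)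
    ultimately obtain s where s: "s \<in> K" "\<And>t. t \<in> K \<Longrightarrow> norm (char M t) \<le> norm (char M s)"
      using continuous_attains_sup False by meson
    \<comment> \<open>The lower cap 1/2 keeps \<open>ln q\<close> meaningful in case the maximum of
      |\<phi>| is 0.\<close>
    define q where "q = max (norm (char M s)) (1/2)"
    have q: "0 < q" "q < 1" using less1[OF s(1)] by (auto simp: q_def)
    show ?thesis
    proof (rule that[of "- ln q"])
      show "norm (char M t) \<le> exp (- (- ln q))" if "e \<le> \<bar>t\<bar>" "\<bar>t\<bar> \<le> pi" for t
        using s(2)[of t] that q by (auto simp: K_def q_def)
    qed (use q in auto)
  qed
qed

text \<open>|exp(iu) - 1| \<le> min(|u|, 2), cut at |u| = 1. This serves \<alpha> < 1; for \<alpha>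
  > 1 the first term would only be of order |t|, which is too large compared with |t|^\<alpha>
  h(1/|t|).\<close>

lemma norm_char_minus_1_le:
  assumes t: "t \<noteq> 0"
  shows "norm (char M t - 1) \<le> \<bar>t\<bar> * (\<integral>y. indicator {-(1/\<bar>t\<bar>)..1/\<bar>t\<bar>} y * \<bar>y\<bar> \<partial>M)
    + 2 * measure M (- {-(1/\<bar>t\<bar>)..1/\<bar>t\<bar>})"
proof -
  define x where "x = 1 / \<bar>t\<bar>"
  have i1: "integrable M (\<lambda>y. indicator {-x..x} y * \<bar>y\<bar>)"
    by (rule integrable_truncated[where B = x]) auto
  have "char M t - 1 = (CLINT y|M. iexp (t * y) - 1)"
    using prob_space by (subst Bochner_Integration.integral_diff) (auto simp: char_def integrable_iexp)
  also have "norm \<dots> \<le> (\<integral>y. \<bar>t\<bar> * (indicator {-x..x} y * \<bar>y\<bar>) + 2 * indicator (- {-x..x}) y \<partial>M)"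
  proof (rule Bochner_Integration.integral_norm_bound_integral)
    fix y
    have "norm (iexp (t * y) - 1) \<le> \<bar>t\<bar> * \<bar>y\<bar>" "norm (iexp (t * y) - 1) \<le> 2"
      using iexp_approx1[of "t * y" 0] iexp_approx2[of "t * y" 0] by (auto simp: abs_mult)
    then show "norm (iexp (t * y) - 1) \<le> \<bar>t\<bar> * (indicator {-x..x} y * \<bar>y\<bar>) + 2 * indicator (- {-x..x}) y"
      by (auto split: split_indicator)
  qed (use i1 in \<open>auto intro!: integrable_iexp simp: emeasure_finite less_top[symmetric]\<close>)
  also have "\<dots> = \<bar>t\<bar> * (\<integral>y. indicator {-x..x} y * \<bar>y\<bar> \<partial>M) + 2 * measure M (- {-x..x})"
    using i1 by (subst Bochner_Integration.integral_add) (auto simp: emeasure_finite less_top[symmetric])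
  finally show ?thesis by (simp add: x_def)
qed

text \<open>Mean zero allows the linear term to be subtracted for free. The remainder is quadratic
  in t y for |y| \<le> 1/|t| and linear beyond, which suits 1 < \<alpha> \<le> 2.\<close>

lemma norm_char_minus_1_le_centered:
  assumes int: "integrable M (\<lambda>y. y)" and mean: "(\<integral>y. y \<partial>M) = 0" and t: "t \<noteq> 0"
  shows "norm (char M t - 1) \<le> t\<^sup>2 * trunc_moment2 (1/\<bar>t\<bar>)
    + 2 * \<bar>t\<bar> * (\<integral>y. indicator (- {-(1/\<bar>t\<bar>)..1/\<bar>t\<bar>}) y * \<bar>y\<bar> \<partial>M)"
proof -
  define x where "x = 1 / \<bar>t\<bar>"
  have i1: "integrable M (\<lambda>y. indicator {-x..x} y * y\<^sup>2)"
    using integrable_truncated_square[of x 0] by simp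
  have i2: "integrable M (\<lambda>y. indicator (- {-x..x}) y * \<bar>y\<bar>)"
    by (rule Bochner_Integration.integrable_bound[OF int]) (auto split: split_indicator)
  have i3: "integrable M (\<lambda>y. \<i> * complex_of_real (t * y))"
    using int by (intro integrable_mult_right integrable_of_real) auto
  have "(CLINT y|M. \<i> * complex_of_real (t * y)) = 0"
    using mean int by simp
  then have "char M t - 1 = (CLINT y|M. iexp (t * y) - 1 - \<i> * complex_of_real (t * y))"
    using prob_space i3
    by (simp add: char_def integrable_iexp Bochner_Integration.integral_diff)
  also have "norm \<dots> \<le> (\<integral>y. t\<^sup>2 * (indicator {-x..x} y * y\<^sup>2)
      + 2 * \<bar>t\<bar> * (indicator (- {-x..x}) y * \<bar>y\<bar>) \<partial>M)"
  proof (rule Bochner_Integration.integral_norm_bound_integral)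
    fix y
    have "norm (iexp (t * y) - 1 - \<i> * complex_of_real (t * y)) \<le> t\<^sup>2 * y\<^sup>2"
    proof -
      have "norm (iexp (t * y) - 1 - \<i> * complex_of_real (t * y)) \<le> t\<^sup>2 * y\<^sup>2 / 2"
        using iexp_approx1[of "t * y" 1] by (simp add: power_mult_distrib power2_eq_square abs_mult algebra_simps)
      moreover have "t\<^sup>2 * y\<^sup>2 \<ge> 0" by simp
      ultimately show ?thesis by linarith
    qed
    moreover have "norm (iexp (t * y) - 1 - \<i> * complex_of_real (t * y)) \<le> 2 * \<bar>t\<bar> * \<bar>y\<bar>"
      using iexp_approx2[of "t * y" 1] by (simp add: abs_mult algebra_simps)
    ultimately show "norm (iexp (t * y) - 1 - \<i> * complex_of_real (t * y))
        \<le> t\<^sup>2 * (indicator {-x..x} y * y\<^sup>2) + 2 * \<bar>t\<bar> * (indicator (- {-x..x}) y * \<bar>y\<bar>)"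
      by (auto split: split_indicator)
    show "integrable M (\<lambda>y. iexp (t * y) - 1 - \<i> * complex_of_real (t * y))"
      using i3 by (intro Bochner_Integration.integrable_diff integrable_iexp) auto
  qed (use i1 i2 in auto)
  also have "\<dots> = t\<^sup>2 * trunc_moment2 x + 2 * \<bar>t\<bar> * (\<integral>y. indicator (- {-x..x}) y * \<bar>y\<bar> \<partial>M)"
    using i1 i2 by (subst Bochner_Integration.integral_add) (auto simp: trunc_moment2_def)
  finally show ?thesis by (simp add: x_def)
qed

end

subsection \<open>Distributions attracted to a stable law\<close>

lemma eventually_at_top_inverse_abs:
  assumes "\<forall>\<^sub>F x in at_top. P (x::real)"
  obtains x0 where "x0 > 0" "\<And>t. t \<noteq> 0 \<Longrightarrow> \<bar>t\<bar> \<le> 1 / x0 \<Longrightarrow> P (1 / \<bar>t\<bar>)"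
proof -
  obtain N where N: "\<And>x. x \<ge> N \<Longrightarrow> P x"
    using assms unfolding eventually_at_top_linorder by blast
  define K where "K = max N 1"
  have K: "K > 0" "N \<le> K" by (auto simp: K_def)
  show ?thesis
  proof (rule that[OF K(1)])
    fix t :: real assume "t \<noteq> 0" "\<bar>t\<bar> \<le> 1 / K"
    then have "K \<le> 1 / \<bar>t\<bar>" using K by (simp add: field_simps)
    then show "P (1 / \<bar>t\<bar>)" using K by (intro N) simp
  qed
qed

text \<open>The two tails enter through their sum, because |\<phi>| and |\<phi> - 1| are estimated
  up to constants; c1 + c2 becomes \<gamma>. For \<alpha> = 2 the truncated second moment takes over
  from the tail as the monotone quantity tied to h.\<close>

locale stable_attraction = real_distribution +
  fixes \<alpha> \<gamma> :: real and h :: "real \<Rightarrow> real"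
  assumes alpha: "0 < \<alpha>" "\<alpha> \<le> 2" "\<alpha> \<noteq> 1"
    and gamma: "0 < \<gamma>"
    and h_double: "((\<lambda>x. h (2 * x) / h x) \<longlongrightarrow> 1) at_top"
    and h_lower: "\<exists>c>0. \<forall>\<^sub>F x in at_top. c \<le> h x"
    and tail_lim: "\<alpha> < 2 \<Longrightarrow>
      ((\<lambda>x. x powr \<alpha> * (measure M {x<..} + measure M {..-x}) / h x) \<longlongrightarrow> \<gamma>) at_top"
    and h_eq_trunc: "\<alpha> = 2 \<Longrightarrow> ((\<lambda>x. trunc_moment2 x / h x) \<longlongrightarrow> 1) at_top"
    and centered: "\<alpha> > 1 \<Longrightarrow> integrable M (\<lambda>y. y) \<and> (\<integral>y. y \<partial>M) = 0"
begin

definition tail :: "real \<Rightarrow> real"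
  where "tail x = measure M {x<..} + measure M {..-x}"

lemma tail_nonneg: "0 \<le> tail x"
  by (simp add: tail_def)

lemma tail_antimono: "x \<le> y \<Longrightarrow> tail y \<le> tail x"
  unfolding tail_def by (intro add_mono finite_measure_mono) auto

lemma measure_outside_le_tail: "0 \<le> x \<Longrightarrow> measure M (- {-x..x}) \<le> tail x"
proof -
  assume "0 \<le> x"
  have "measure M (- {-x..x}) \<le> measure M ({x<..} \<union> {..-x})"
    by (intro finite_measure_mono) auto
  also have "\<dots> \<le> tail x"
    unfolding tail_def by (intro measure_subadditive) (auto simp: emeasure_finite)
  finally show ?thesis .
qed

section \<open>Regularity of h at infinity\<close>

lemma h_pos: "\<forall>\<^sub>F x in at_top. 0 < h x"
  using h_lower by (auto elim: eventually_mono)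

lemma h_double_le:
  assumes "1 < q"
  shows "\<forall>\<^sub>F x in at_top. h (2 * x) \<le> q * h x"
proof -
  have "\<forall>\<^sub>F x in at_top. h (2 * x) / h x < q"
    using h_double assms by (rule order_tendstoD)
  with h_pos show ?thesis by eventually_elim (simp add: field_simps)
qed

lemma h_double_ge:
  assumes "q < 1"
  shows "\<forall>\<^sub>F x in at_top. q * h x \<le> h (2 * x)"
proof -
  have "\<forall>\<^sub>F x in at_top. q < h (2 * x) / h x"
    using h_double assms by (rule order_tendstoD)
  with h_pos show ?thesis by eventually_elim (simp add: field_simps)
qed

lemma tail_bounds:
  assumes "\<alpha> < 2"
  shows "\<forall>\<^sub>F x in at_top. \<gamma> / 2 * (x powr (-\<alpha>) * h x) \<le> tail x
    \<and> tail x \<le> 2 * \<gamma> * (x powr (-\<alpha>) * h x)"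
proof -
  have "\<forall>\<^sub>F x in at_top. \<gamma> / 2 < x powr \<alpha> * tail x / h x"
    and "\<forall>\<^sub>F x in at_top. x powr \<alpha> * tail x / h x < 2 * \<gamma>"
    using order_tendstoD(1)[OF tail_lim[OF assms, folded tail_def], of "\<gamma> / 2"]
      order_tendstoD(2)[OF tail_lim[OF assms, folded tail_def], of "2 * \<gamma>"] gamma by simp_all
  with h_pos eventually_gt_at_top[of 0] show ?thesis
    by eventually_elim (simp add: field_simps powr_minus)
qed

lemma trunc_moment2_bounds:
  assumes "\<alpha> = 2"
  shows "\<forall>\<^sub>F x in at_top. h x / 2 \<le> trunc_moment2 x \<and> trunc_moment2 x \<le> 2 * h x"
proof -
  have "\<forall>\<^sub>F x in at_top. 1 / 2 < trunc_moment2 x / h x"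
    and "\<forall>\<^sub>F x in at_top. trunc_moment2 x / h x < 2"
    using order_tendstoD(1)[OF h_eq_trunc[OF assms], of "1 / 2"]
      order_tendstoD(2)[OF h_eq_trunc[OF assms], of 2] by simp_all
  with h_pos show ?thesis by eventually_elim (simp add: field_simps)
qed

text \<open>Slow variation alone does not compare \<open>h\<close> at nearby points without the uniform convergence
  theorem; here monotonicity of the tail or of the truncated second moment replaces it.\<close>

lemma h_quasi_mono:
  obtains c where "c > 0" "\<forall>\<^sub>F x in at_top. \<forall>y. x \<le> y \<longrightarrow> y \<le> 2 * x \<longrightarrow> c * h y \<le> h x"
proof (cases "\<alpha> < 2")
  case True
  obtain N where N: "\<And>x. x \<ge> N \<Longrightarrow> \<gamma> / 2 * (x powr (-\<alpha>) * h x) \<le> tail x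
    \<and> tail x \<le> 2 * \<gamma> * (x powr (-\<alpha>) * h x)"
    using tail_bounds[OF True] unfolding eventually_at_top_linorder by blast
  have "\<forall>\<^sub>F x in at_top. \<forall>y. x \<le> y \<longrightarrow> y \<le> 2 * x \<longrightarrow> 1 / (4 * 2 powr \<alpha>) * h y \<le> h x"
    using eventually_ge_at_top[of N] eventually_gt_at_top[of 0] h_pos
  proof eventually_elim
    case (elim x)
    show ?case
    proof (intro allI impI)
      fix y assume y: "x \<le> y" "y \<le> 2 * x"
      have "\<gamma> / 2 * h y = y powr \<alpha> * (\<gamma> / 2 * (y powr (-\<alpha>) * h y))"
        using y elim by (simp add: powr_minus)
      also have "\<dots> \<le> y powr \<alpha> * tail y"
        using N[of y] y elim by (intro mult_left_mono) auto
      also have "\<dots> \<le> (2 * x) powr \<alpha> * tail x"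
        using y elim alpha by (intro mult_mono powr_mono2 tail_antimono tail_nonneg) auto
      also have "\<dots> \<le> (2 * x) powr \<alpha> * (2 * \<gamma> * (x powr (-\<alpha>) * h x))"
        using N[of x] elim by (intro mult_left_mono) auto
      also have "\<dots> = 2 powr \<alpha> * 2 * \<gamma> * h x"
        using elim by (simp add: powr_mult powr_minus)
      \<comment> \<open>Each of the two tail bounds loses a factor 2, and replacing y^\<alpha> by
        (2x)^\<alpha> loses 2^\<alpha>.\<close>
      finally have "h y \<le> 4 * 2 powr \<alpha> * h x" using gamma by simp
      then show "1 / (4 * 2 powr \<alpha>) * h y \<le> h x" by (simp add: field_simps)
    qed
  qed
  then show ?thesis by (rule that[rotated]) simp
next
  case False
  then have 2: "\<alpha> = 2" using alpha by simp
  obtain N where N: "\<And>x. x \<ge> N \<Longrightarrow> h x / 2 \<le> trunc_moment2 x \<and> trunc_moment2 x \<le> 2 * h x"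
    using trunc_moment2_bounds[OF 2] unfolding eventually_at_top_linorder by blast
  have "\<forall>\<^sub>F x in at_top. \<forall>y. x \<le> y \<longrightarrow> y \<le> 2 * x \<longrightarrow> 1 / 8 * h y \<le> h x"
    using eventually_ge_at_top[of N] eventually_gt_at_top[of 0] h_double_le[of 2, simplified]
  proof eventually_elim
    case (elim x)
    show ?case
    proof (intro allI impI)
      fix y assume y: "x \<le> y" "y \<le> 2 * x"
      \<comment> \<open>The chain is h(y)/2 \<le> V(y) \<le> V(2x) \<le> 2 h(2x) \<le> 4 h(x), with
        V the truncated second moment.\<close>
      show "1 / 8 * h y \<le> h x"
        using N[of y] N[of "2 * x"] trunc_moment2_mono[OF y(2)] y elim by auto
    qed
  qed
  then show ?thesis by (rule that[rotated]) simp
qed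

text \<open>Since eventually h(2x) \<le> 2^(\<alpha>/2) h(x), the function x^(-\<alpha>/2) h(x) does
  not increase under doubling, and quasi-monotonicity within one block does the rest. Any exponent
  strictly between 0 and \<alpha> would do: what remains of |t|^\<alpha> must still be a positive
  power.\<close>

lemma h_potter:
  obtains c x0 where "c > 0" "x0 > 0"
    "\<And>x y. x0 \<le> x \<Longrightarrow> x \<le> y \<Longrightarrow> c * (y powr (-(\<alpha>/2)) * h y) \<le> x powr (-(\<alpha>/2)) * h x"
proof -
  obtain c where c: "c > 0"
    and ev: "\<forall>\<^sub>F x in at_top. \<forall>y. x \<le> y \<longrightarrow> y \<le> 2 * x \<longrightarrow> c * h y \<le> h x"
    by (rule h_quasi_mono)
  define q where "q = 2 powr (\<alpha>/2)"
  have q: "q > 1" using alpha by (simp add: q_def gr_one_powr)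
  have "\<forall>\<^sub>F x in at_top. (\<forall>y. x \<le> y \<longrightarrow> y \<le> 2 * x \<longrightarrow> c * h y \<le> h x)
      \<and> h (2 * x) \<le> q * h x \<and> 0 < x \<and> 0 < h x"
    using ev h_double_le[OF q] eventually_gt_at_top[of 0] h_pos by eventually_elim auto
  then obtain x0 where x0: "\<And>x y. x \<ge> x0 \<Longrightarrow> x \<le> y \<Longrightarrow> y \<le> 2 * x \<Longrightarrow> c * h y \<le> h x"
      "\<And>x. x \<ge> x0 \<Longrightarrow> h (2 * x) \<le> q * h x" "\<And>x. x \<ge> x0 \<Longrightarrow> 0 < x" "\<And>x. x \<ge> x0 \<Longrightarrow> 0 < h x"
    unfolding eventually_at_top_linorder by blast
  have "c * (y powr (-(\<alpha>/2)) * h y) \<le> x powr (-(\<alpha>/2)) * h x" if "x0 \<le> x" "x \<le> y" for x y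
  proof (rule dyadic_quasi_decreasing[OF x0(3)[OF order_refl] _ _ that])
    fix x assume x: "x \<ge> x0"
    have "(2 * x) powr (-(\<alpha>/2)) * h (2 * x) \<le> (2 * x) powr (-(\<alpha>/2)) * (q * h x)"
      using x0(2)[OF x] by (intro mult_left_mono) auto
    also have "\<dots> = x powr (-(\<alpha>/2)) * h x"
      using x0(3)[OF x] by (simp add: powr_mult q_def powr_minus)
    finally show "(2 * x) powr (-(\<alpha>/2)) * h (2 * x) \<le> x powr (-(\<alpha>/2)) * h x" .
  next
    fix x y assume x: "x \<ge> x0" and y: "x \<le> y" "y \<le> 2 * x"
    have "y powr (-(\<alpha>/2)) * (c * h y) \<le> x powr (-(\<alpha>/2)) * h x"
      using x0(1)[OF x y] x0(3)[OF x] x0(4)[of y] x y alpha c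
      by (intro mult_mono powr_mono2') auto
    then show "c * (y powr (-(\<alpha>/2)) * h y) \<le> x powr (-(\<alpha>/2)) * h x" by (simp add: mult_ac)
  qed
  then show ?thesis using that[OF c x0(3)[OF order_refl]] by blast
qed

section \<open>Truncated moments compared with h\<close>

lemma trunc_moment2_ge_tail_diff:
  assumes "x > 0"
  shows "x\<^sup>2 * (tail x - tail (2 * x)) \<le> trunc_moment2 (2 * x)"
proof -
  let ?A = "\<lambda>x. {x<..} \<union> {..-x}"
  have t: "tail z = measure M (?A z)" if "z > 0" for z
    unfolding tail_def using that by (subst finite_measure_Union) auto
  have "x\<^sup>2 * (tail x - tail (2 * x)) = (\<integral>y. x\<^sup>2 * (indicator (?A x) y - indicator (?A (2 * x)) y) \<partial>M)"
    using assms by (simp add: t emeasure_finite less_top[symmetric])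
  also have "\<dots> \<le> trunc_moment2 (2 * x)"
    unfolding trunc_moment2_def
  proof (rule integral_mono)
    show "integrable M (\<lambda>y. indicator {-(2 * x)..2 * x} y * y\<^sup>2)"
      using integrable_truncated_square[of "2 * x" 0] by simp
    fix y :: real
    show "x\<^sup>2 * (indicator (?A x) y - indicator (?A (2 * x)) y) \<le> indicator {-(2 * x)..2 * x} y * y\<^sup>2"
    proof (cases "x \<le> \<bar>y\<bar>")
      case True
      then have "x\<^sup>2 \<le> y\<^sup>2" using assms abs_le_square_iff[of x y] by simp
      then show ?thesis using assms by (auto split: split_indicator)
    qed (use assms in \<open>auto split: split_indicator\<close>)
  qed (auto simp: emeasure_finite less_top[symmetric])
  finally show ?thesis .
qed

text \<open>For \<alpha> < 2 the values of modulus between x and 2x already contribute enough. Their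
  mass is a difference of tails, which two-sided bounds cannot control from below, so the limit of
  the tail ratio itself is used: tail(x) - tail(2x) is asymptotic to \<gamma> (1 - 2^(-\<alpha>))
  x^(-\<alpha>) h(x), and k is half of that constant.\<close>

lemma trunc_moment2_ge:
  obtains c where "c > 0" "\<forall>\<^sub>F x in at_top. c * (x powr (2 - \<alpha>) * h x) \<le> trunc_moment2 x"
proof (cases "\<alpha> < 2")
  case True
  define g where "g = (\<lambda>x. x powr \<alpha> * tail x / h x)"
  have g: "(g \<longlongrightarrow> \<gamma>) at_top" using tail_lim[OF True] by (simp add: g_def tail_def)
  have "filterlim (\<lambda>x::real. 2 * x) at_top at_top"
    by (intro filterlim_tendsto_pos_mult_at_top[OF tendsto_const _ filterlim_ident]) simp
  then have g2: "((\<lambda>x. g (2 * x)) \<longlongrightarrow> \<gamma>) at_top"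
    by (rule filterlim_compose[OF g])
  have "((\<lambda>x. g x - 2 powr (-\<alpha>) * (g (2 * x) * (h (2 * x) / h x)))
      \<longlongrightarrow> \<gamma> - 2 powr (-\<alpha>) * (\<gamma> * 1)) at_top"
    by (intro tendsto_intros g g2 h_double)
  moreover define k where "k = \<gamma> * (1 - 2 powr (-\<alpha>)) / 2"
  have "2 powr (-\<alpha>) < (1::real)" using alpha by (simp add: powr_less_one)
  then have k: "k > 0" using gamma by (simp add: k_def)
  have "\<gamma> - 2 powr (-\<alpha>) * (\<gamma> * 1) = 2 * k" by (simp add: k_def algebra_simps)
  then have "k < \<gamma> - 2 powr (-\<alpha>) * (\<gamma> * 1)" using k by linarith
  ultimately have ev: "\<forall>\<^sub>F x in at_top. k < g x - 2 powr (-\<alpha>) * (g (2 * x) * (h (2 * x) / h x))"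
    by (rule order_tendstoD)
  obtain N where N: "N > 0" "\<And>x. x \<ge> N \<Longrightarrow> 0 < h x"
    using eventually_conj[OF h_pos eventually_gt_at_top[of 0]]
    unfolding eventually_at_top_linorder by blast
  have "\<forall>\<^sub>F x in at_top. k * (x powr (-\<alpha>) * h x) \<le> tail x - tail (2 * x)"
    using ev eventually_ge_at_top[of N]
  proof eventually_elim
    case (elim x)
    have "g x - 2 powr (-\<alpha>) * (g (2 * x) * (h (2 * x) / h x))
        = (tail x - tail (2 * x)) * (x powr \<alpha> / h x)"
      using N(1) N(2)[of x] N(2)[of "2 * x"] elim
      by (simp add: g_def powr_mult powr_minus field_simps)
    then have "k \<le> (tail x - tail (2 * x)) * (x powr \<alpha> / h x)" using elim by simp
    then show ?case using N(1) N(2)[of x] elim by (simp add: field_simps powr_minus)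
  qed
  then have "\<forall>\<^sub>F x in at_top. k / 8 * ((2 * x) powr (2 - \<alpha>) * h (2 * x)) \<le> trunc_moment2 (2 * x)"
    using h_double_le[of 2, simplified] eventually_gt_at_top[of 0] h_pos
  proof eventually_elim
    case (elim x)
    \<comment> \<open>The divisor 8 pays for 2^(2-\<alpha>) \<le> 4 and for h(2x) \<le> 2
      h(x).\<close>
    have "(2::real) powr (2 - \<alpha>) \<le> 2 powr 2" using alpha by (intro powr_mono) auto
    then have p2: "(2::real) powr (2 - \<alpha>) / 4 \<le> 1" by simp
    have "k / 8 * ((2 * x) powr (2 - \<alpha>) * h (2 * x))
        \<le> k / 8 * ((2 * x) powr (2 - \<alpha>) * (2 * h x))"
      using elim k by (intro mult_left_mono) auto
    also have "\<dots> = (2 powr (2 - \<alpha>) / 4) * (k * (x powr (2 - \<alpha>) * h x))"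
      using elim by (simp add: powr_mult)
    also have "\<dots> \<le> 1 * (k * (x powr (2 - \<alpha>) * h x))"
      using p2 elim k by (intro mult_right_mono) auto
    also have "\<dots> = x\<^sup>2 * (k * (x powr (-\<alpha>) * h x))"
      using elim by (simp add: powr_diff powr_minus divide_inverse)
    also have "\<dots> \<le> x\<^sup>2 * (tail x - tail (2 * x))"
      using elim by (intro mult_left_mono) auto
    also have "\<dots> \<le> trunc_moment2 (2 * x)"
      using elim by (intro trunc_moment2_ge_tail_diff) auto
    finally show ?case .
  qed
  then obtain N' where N': "\<And>x. x \<ge> N' \<Longrightarrow>
      k / 8 * ((2 * x) powr (2 - \<alpha>) * h (2 * x)) \<le> trunc_moment2 (2 * x)"
    unfolding eventually_at_top_linorder by blast
  have "\<forall>\<^sub>F x in at_top. k / 8 * (x powr (2 - \<alpha>) * h x) \<le> trunc_moment2 x"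
    using eventually_ge_at_top[of "2 * N'"]
    by eventually_elim (use N'[of "x / 2" for x] in simp)
  then show ?thesis by (rule that[rotated]) (use k in simp)
next
  case False
  then have 2: "\<alpha> = 2" using alpha by simp
  have "\<forall>\<^sub>F x in at_top. 1 / 2 * (x powr (2 - \<alpha>) * h x) \<le> trunc_moment2 x"
    using trunc_moment2_bounds[OF 2] eventually_gt_at_top[of 0]
    by eventually_elim (simp add: 2)
  then show ?thesis by (rule that[rotated]) simp
qed

text \<open>The upper half of Karamata's theorem. Doubling x adds at most (2x)^p tail(x), of order
  x^(p-\<alpha>) h(x), and p > \<alpha> makes this comparison function grow geometrically. The cases
  needed are p = 2, and p = 1 when \<alpha> < 1.\<close>

lemma trunc_moment_le:
  assumes "\<alpha> < 2" and p: "\<alpha> < p"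
  obtains C where "\<forall>\<^sub>F x in at_top. (\<integral>y. indicator {-x..x} y * \<bar>y\<bar> powr p \<partial>M) \<le> C * (x powr (p - \<alpha>) * h x)"
proof -
  define F where "F = (\<lambda>x. \<integral>y. indicator {-x..x} y * \<bar>y\<bar> powr p \<partial>M)"
  have int: "integrable M (\<lambda>y. indicator {-x..x} y * \<bar>y\<bar> powr p)" for x
    using p alpha by (intro integrable_truncated[where B = "x powr p"]) (auto intro!: powr_mono2)
  have F_mono: "F x \<le> F y" if "x \<le> y" for x y
    unfolding F_def using int that by (intro integral_mono) (auto split: split_indicator)
  have F_step: "F (2 * x) \<le> F x + (2 * x) powr p * tail x" if x: "x > 0" for x
  proof -
    have "F (2 * x) \<le> (\<integral>y. indicator {-x..x} y * \<bar>y\<bar> powr p + (2 * x) powr p * indicator (- {-x..x}) y \<partial>M)"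
      unfolding F_def
    proof (rule integral_mono)
      fix y :: real
      show "indicator {-(2 * x)..2 * x} y * \<bar>y\<bar> powr p
          \<le> indicator {-x..x} y * \<bar>y\<bar> powr p + (2 * x) powr p * indicator (- {-x..x}) y"
        using x p alpha powr_mono2[of p "\<bar>y\<bar>" "2 * x"] by (auto split: split_indicator)
    qed (use int in \<open>auto simp: emeasure_finite less_top[symmetric]\<close>)
    also have "\<dots> = F x + (2 * x) powr p * measure M (- {-x..x})"
      using int by (subst Bochner_Integration.integral_add)
        (auto simp: F_def emeasure_finite less_top[symmetric])
    also have "\<dots> \<le> F x + (2 * x) powr p * tail x"
      using measure_outside_le_tail x by (intro add_left_mono mult_left_mono) auto
    finally show ?thesis .
  qed
  obtain c where c: "c > 0" "\<forall>\<^sub>F x in at_top. c \<le> h x" using h_lower by blast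
  \<comment> \<open>Doubling multiplies x^(p-\<alpha>) by q^2. One factor q is given up to cover a
    possible decrease of h, the other remains as growth rate.\<close>
  define q where "q = 2 powr ((p - \<alpha>) / 2)"
  have q: "q > 1" using p by (simp add: q_def gr_one_powr)
  have q': "1 / q < 1" using q by simp
  have "\<forall>\<^sub>F x in at_top. c \<le> h x \<and> 0 < x \<and> 1 / q * h x \<le> h (2 * x)
      \<and> tail x \<le> 2 * \<gamma> * (x powr (-\<alpha>) * h x)"
    using c(2) eventually_gt_at_top[of 0] h_double_ge[OF q'] tail_bounds[OF assms(1)]
    by eventually_elim blast
  then obtain x0 where x0: "\<And>x. x \<ge> x0 \<Longrightarrow> c \<le> h x" "\<And>x. x \<ge> x0 \<Longrightarrow> 0 < x"
      "\<And>x. x \<ge> x0 \<Longrightarrow> 1 / q * h x \<le> h (2 * x)"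
      "\<And>x. x \<ge> x0 \<Longrightarrow> tail x \<le> 2 * \<gamma> * (x powr (-\<alpha>) * h x)"
    unfolding eventually_at_top_linorder by blast
  define r where "r = (\<lambda>x. x powr (p - \<alpha>) * h x)"
  define C where "C = 2 powr p * 2 * \<gamma>"
  \<comment> \<open>On the first block F is at most F(2 x0), while the comparison function is at
    least x0^(p-\<alpha>) c.\<close>
  define D where "D = F (2 * x0) / (x0 powr (p - \<alpha>) * c)"
  have x00: "x0 > 0" using x0(2) by simp
  have F0: "F (2 * x0) \<ge> 0" unfolding F_def by (intro integral_nonneg_AE) auto
  have "F x \<le> (D + C / (q - 1)) * r x" if "x \<ge> x0" for x
  proof (rule dyadic_comparison_upward[OF x00 q _ _ _ _ _ _ that])
    show "C \<ge> 0" using gamma by (simp add: C_def)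
    show "D \<ge> 0" using F0 c by (simp add: D_def)
    fix x assume x: "x \<ge> x0"
    note x0' = x0[OF x]
    have "F (2 * x) \<le> F x + (2 * x) powr p * (2 * \<gamma> * (x powr (-\<alpha>) * h x))"
      using F_step[OF x0'(2)] x0'(4) by (meson add_left_mono mult_left_mono order_trans powr_ge_zero)
    also have "(2 * x) powr p * (2 * \<gamma> * (x powr (-\<alpha>) * h x)) = C * r x"
      using x0'(2) by (simp add: C_def r_def powr_mult powr_diff powr_minus field_simps)
    finally show "F (2 * x) \<le> F x + C * r x" .
    show "0 \<le> r x" using x0' c by (simp add: r_def)
    have "q * r x = (2 * x) powr (p - \<alpha>) * (1 / q * h x)"
    proof -
      have "(2::real) powr (p - \<alpha>) = q * q" by (simp add: q_def powr_add[symmetric])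
      then show ?thesis using x0'(2) q by (simp add: r_def powr_mult)
    qed
    also have "\<dots> \<le> r (2 * x)" unfolding r_def using x0'(3) by (intro mult_left_mono) auto
    finally show "q * r x \<le> r (2 * x)" .
    show "F x \<le> D * r x" if "x \<le> 2 * x0"
    proof -
      have "F x \<le> D * (x0 powr (p - \<alpha>) * c)"
        using F_mono[OF that] x00 c by (simp add: D_def)
      also have "\<dots> \<le> D * r x"
        unfolding r_def using x x00 x0' c p \<open>D \<ge> 0\<close>
        by (intro mult_left_mono mult_mono powr_mono2) auto
      finally show ?thesis .
    qed
  qed
  then show ?thesis
    using that[of "D + C / (q - 1)"] unfolding eventually_at_top_linorder F_def r_def by blast
qed

lemma trunc_moment2_le:
  obtains C where "C \<ge> 0" "\<forall>\<^sub>F x in at_top. trunc_moment2 x \<le> C * (x powr (2 - \<alpha>) * h x)"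
proof -
  have "\<exists>C. \<forall>\<^sub>F x in at_top. trunc_moment2 x \<le> C * (x powr (2 - \<alpha>) * h x)"
  proof (cases "\<alpha> < 2")
    case True
    then show ?thesis using trunc_moment_le[of 2] by (auto simp: trunc_moment2_def)
  next
    case False
    then have 2: "\<alpha> = 2" using alpha by simp
    have "\<forall>\<^sub>F x in at_top. trunc_moment2 x \<le> 2 * (x powr (2 - \<alpha>) * h x)"
      using trunc_moment2_bounds[OF 2] eventually_gt_at_top[of 0]
      by eventually_elim (simp add: 2)
    then show ?thesis by blast
  qed
  then obtain C where C: "\<forall>\<^sub>F x in at_top. trunc_moment2 x \<le> C * (x powr (2 - \<alpha>) * h x)"
    by blast
  have "\<forall>\<^sub>F x in at_top. trunc_moment2 x \<le> max C 0 * (x powr (2 - \<alpha>) * h x)"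
    using C h_pos
  proof eventually_elim
    case (elim x)
    then have "C * (x powr (2 - \<alpha>) * h x) \<le> max C 0 * (x powr (2 - \<alpha>) * h x)"
      by (intro mult_right_mono) auto
    then show ?case using elim by simp
  qed
  then show ?thesis by (rule that[rotated]) simp
qed

text \<open>Integrability makes F vanish at infinity, and F is controlled from there. The step uses
  |y| \<le> y^2/x for |y| \<ge> x, that is, the truncated second moment instead of the tail, so that
  \<alpha> = 2, where the locale gives no tail asymptotics, falls under the same argument.\<close>

lemma tail_moment_le:
  assumes "\<alpha> > 1"
  obtains C where "\<forall>\<^sub>F x in at_top. (\<integral>y. indicator (- {-x..x}) y * \<bar>y\<bar> \<partial>M) \<le> C * (x powr (1 - \<alpha>) * h x)"
proof -
  define F where "F = (\<lambda>x. \<integral>y. indicator (- {-x..x}) y * \<bar>y\<bar> \<partial>M)"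
  have id: "integrable M (\<lambda>y. y)" using centered[OF assms] by simp
  have int: "integrable M (\<lambda>y. indicator (- {-x..x}) y * \<bar>y\<bar>)" for x
    by (rule Bochner_Integration.integrable_bound[OF id]) (auto split: split_indicator)
  have int2: "integrable M (\<lambda>y. indicator {-x..x} y * y\<^sup>2)" for x
    using integrable_truncated_square[of x 0] by simp
  have F_lim: "(F \<longlongrightarrow> 0) at_top"
  proof -
    have "(F \<longlongrightarrow> (\<integral>y. 0 \<partial>M)) at_top"
      unfolding F_def
    proof (rule integral_dominated_convergence_at_top)
      show "integrable M (\<lambda>y. \<bar>y\<bar>)" using id by simp
      show "\<forall>\<^sub>F x in at_top. AE y in M. norm (indicator (- {-x..x}) y * \<bar>y\<bar>) \<le> \<bar>y\<bar>"
        by (intro always_eventually allI AE_I2) (auto split: split_indicator)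
      have "((\<lambda>x. indicator (- {-x..x}) y * \<bar>y\<bar>) \<longlongrightarrow> 0) at_top" for y :: real
      proof (rule tendsto_eventually)
        show "\<forall>\<^sub>F x in at_top. indicator (- {-x..x}) y * \<bar>y\<bar> = 0"
          using eventually_ge_at_top[of "\<bar>y\<bar>"]
          by eventually_elim (auto split: split_indicator)
      qed
      then show "AE y in M. ((\<lambda>x. indicator (- {-x..x}) y * \<bar>y\<bar>) \<longlongrightarrow> 0) at_top" by simp
    qed auto
    then show ?thesis by simp
  qed
  have F_step: "F x \<le> F (2 * x) + trunc_moment2 (2 * x) / x" if x: "x > 0" for x
  proof -
    have "F x \<le> (\<integral>y. indicator (- {-(2 * x)..2 * x}) y * \<bar>y\<bar> + 1 / x * (indicator {-(2 * x)..2 * x} y * y\<^sup>2) \<partial>M)"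
      unfolding F_def
    proof (rule integral_mono)
      fix y :: real
      have "\<bar>y\<bar> \<le> y\<^sup>2 / x" if "x \<le> \<bar>y\<bar>"
      proof -
        have "\<bar>y\<bar> * x \<le> \<bar>y\<bar> * \<bar>y\<bar>" using that by (intro mult_left_mono) auto
        then show ?thesis using x by (simp add: field_simps power2_eq_square)
      qed
      then show "indicator (- {-x..x}) y * \<bar>y\<bar> \<le> indicator (- {-(2 * x)..2 * x}) y * \<bar>y\<bar>
          + 1 / x * (indicator {-(2 * x)..2 * x} y * y\<^sup>2)"
        using x by (auto split: split_indicator)
    qed (use int int2 in auto)
    also have "\<dots> = F (2 * x) + trunc_moment2 (2 * x) / x"
      using int int2 by (subst Bochner_Integration.integral_add) (auto simp: F_def trunc_moment2_def)
    finally show ?thesis .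
  qed
  obtain C where C: "C \<ge> 0" "\<forall>\<^sub>F x in at_top. trunc_moment2 x \<le> C * (x powr (2 - \<alpha>) * h x)"
    by (rule trunc_moment2_le)
  \<comment> \<open>Doubling multiplies x^(1-\<alpha>) by q^(-2); one of the two factors is spent on
    a possible increase of h.\<close>
  define q where "q = 2 powr ((\<alpha> - 1) / 2)"
  have q: "q > 1" using assms by (simp add: q_def gr_one_powr)
  have "\<forall>\<^sub>F x in at_top. trunc_moment2 x \<le> C * (x powr (2 - \<alpha>) * h x)
      \<and> h (2 * x) \<le> q * h x \<and> 0 < x \<and> 0 < h x"
    using C(2) h_double_le[OF q] eventually_gt_at_top[of 0] h_pos by eventually_elim auto
  then obtain x0 where x0: "\<And>x. x \<ge> x0 \<Longrightarrow> trunc_moment2 x \<le> C * (x powr (2 - \<alpha>) * h x)"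
      "\<And>x. x \<ge> x0 \<Longrightarrow> h (2 * x) \<le> q * h x" "\<And>x. x \<ge> x0 \<Longrightarrow> 0 < x" "\<And>x. x \<ge> x0 \<Longrightarrow> 0 < h x"
    unfolding eventually_at_top_linorder by blast
  define r where "r = (\<lambda>x. x powr (1 - \<alpha>) * h x)"
  define D where "D = C * 2 powr (2 - \<alpha>) * q"
  have x00: "x0 > 0" using x0(3) by simp
  have "F x \<le> D / (1 - 1 / q) * r x" if "x \<ge> x0" for x
  proof (rule dyadic_comparison_downward[OF x00 _ _ _ _ _ F_lim that])
    show "1 / q < 1" using q by simp
    show "D \<ge> 0" using C q by (simp add: D_def)
    fix x assume x: "x \<ge> x0"
    note x0' = x0[OF x]
    have "trunc_moment2 (2 * x) / x \<le> C * ((2 * x) powr (2 - \<alpha>) * (q * h x)) / x"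
    proof -
      have "trunc_moment2 (2 * x) \<le> C * ((2 * x) powr (2 - \<alpha>) * h (2 * x))"
        using x x00 by (intro x0(1)) auto
      also have "\<dots> \<le> C * ((2 * x) powr (2 - \<alpha>) * (q * h x))"
        using x0'(2) C(1) by (intro mult_left_mono) auto
      finally show ?thesis using x0'(3) by (intro divide_right_mono) auto
    qed
    also have "\<dots> = D * r x"
    proof -
      have "x powr (2 - \<alpha>) = x * x powr (1 - \<alpha>)"
        using x0'(3) by (simp add: powr_mult_base)
      then show ?thesis using x0'(3) by (simp add: D_def r_def powr_mult)
    qed
    finally show "F x \<le> F (2 * x) + D * r x" using F_step[OF x0'(3)] by simp
    show "0 \<le> r x" using x0' by (simp add: r_def)
    have "r (2 * x) \<le> (2 * x) powr (1 - \<alpha>) * (q * h x)"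
      unfolding r_def using x0'(2) by (intro mult_left_mono) auto
    also have "\<dots> = 1 / q * r x"
    proof -
      have "(2::real) powr (1 - \<alpha>) * (q * q) = 1"
        by (simp add: q_def powr_add[symmetric])
      then have "(2::real) powr (1 - \<alpha>) * q = 1 / q" using q by (simp add: field_simps)
      moreover have "(2 * x) powr (1 - \<alpha>) * (q * h x) = (2 powr (1 - \<alpha>) * q) * r x"
        using x0'(3) by (simp add: r_def powr_mult)
      ultimately show ?thesis by simp
    qed
    finally show "r (2 * x) \<le> 1 / q * r x" .
  qed
  then show ?thesis
    using that[of "D / (1 - 1 / q)"] unfolding eventually_at_top_linorder F_def r_def by blast
qed

text \<open>At x = 1/|t| a moment of order p, cut to the side where it is governed by the tail, is
  of order x^(p-\<alpha>) h(x), and its prefactor |t|^p turns this into |t|^\<alpha> h(1/|t|). The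
  value \<alpha> = 1 is the borderline where the first moment can be cut on neither side.\<close>

lemma norm_char_minus_1_le_h:
  obtains C x0 where "x0 > 0"
    "\<And>t. t \<noteq> 0 \<Longrightarrow> \<bar>t\<bar> \<le> 1 / x0 \<Longrightarrow> norm (char M t - 1) \<le> C * (\<bar>t\<bar> powr \<alpha> * h (1 / \<bar>t\<bar>))"
proof -
  show ?thesis
  proof (cases "\<alpha> > 1")
    case True
    obtain C1 where C1: "C1 \<ge> 0" "\<forall>\<^sub>F x in at_top. trunc_moment2 x \<le> C1 * (x powr (2 - \<alpha>) * h x)"
      by (rule trunc_moment2_le)
    obtain C2 where C2: "\<forall>\<^sub>F x in at_top. (\<integral>y. indicator (- {-x..x}) y * \<bar>y\<bar> \<partial>M) \<le> C2 * (x powr (1 - \<alpha>) * h x)"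
      using tail_moment_le[OF True] .
    obtain x0 where x0: "x0 > 0" "\<And>t. t \<noteq> 0 \<Longrightarrow> \<bar>t\<bar> \<le> 1 / x0 \<Longrightarrow>
        trunc_moment2 (1/\<bar>t\<bar>) \<le> C1 * ((1/\<bar>t\<bar>) powr (2 - \<alpha>) * h (1/\<bar>t\<bar>)) \<and>
        (\<integral>y. indicator (- {-(1/\<bar>t\<bar>)..1/\<bar>t\<bar>}) y * \<bar>y\<bar> \<partial>M) \<le> C2 * ((1/\<bar>t\<bar>) powr (1 - \<alpha>) * h (1/\<bar>t\<bar>))"
      using eventually_at_top_inverse_abs[OF eventually_conj[OF C1(2) C2]] by blast
    show ?thesis
    proof (rule that[OF x0(1)])
      fix t :: real assume t: "t \<noteq> 0" "\<bar>t\<bar> \<le> 1 / x0"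
      have "norm (char M t - 1) \<le> t\<^sup>2 * trunc_moment2 (1/\<bar>t\<bar>)
          + 2 * \<bar>t\<bar> * (\<integral>y. indicator (- {-(1/\<bar>t\<bar>)..1/\<bar>t\<bar>}) y * \<bar>y\<bar> \<partial>M)"
        using centered[OF True] t by (intro norm_char_minus_1_le_centered) auto
      also have "\<dots> \<le> t\<^sup>2 * (C1 * ((1/\<bar>t\<bar>) powr (2 - \<alpha>) * h (1/\<bar>t\<bar>)))
          + 2 * \<bar>t\<bar> * (C2 * ((1/\<bar>t\<bar>) powr (1 - \<alpha>) * h (1/\<bar>t\<bar>)))"
        using x0(2)[OF t] by (intro add_mono mult_left_mono) auto
      also have "t\<^sup>2 * (C1 * ((1/\<bar>t\<bar>) powr (2 - \<alpha>) * h (1/\<bar>t\<bar>))) = C1 * (\<bar>t\<bar> powr \<alpha> * h (1/\<bar>t\<bar>))"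
        using t(1) by (simp add: powr_divide powr_diff)
      also have "2 * \<bar>t\<bar> * (C2 * ((1/\<bar>t\<bar>) powr (1 - \<alpha>) * h (1/\<bar>t\<bar>))) = 2 * C2 * (\<bar>t\<bar> powr \<alpha> * h (1/\<bar>t\<bar>))"
        using t(1) by (simp add: powr_divide powr_diff)
      finally show "norm (char M t - 1) \<le> (C1 + 2 * C2) * (\<bar>t\<bar> powr \<alpha> * h (1/\<bar>t\<bar>))"
        by (simp add: distrib_right)
    qed
  next
    case False
    then have a1: "\<alpha> < 1" using alpha by simp
    obtain C1 where C1: "\<forall>\<^sub>F x in at_top. (\<integral>y. indicator {-x..x} y * \<bar>y\<bar> powr 1 \<partial>M) \<le> C1 * (x powr (1 - \<alpha>) * h x)"
      using trunc_moment_le[of 1] a1 by auto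
    obtain x0 where x0: "x0 > 0" "\<And>t. t \<noteq> 0 \<Longrightarrow> \<bar>t\<bar> \<le> 1 / x0 \<Longrightarrow>
        (\<integral>y. indicator {-(1/\<bar>t\<bar>)..1/\<bar>t\<bar>} y * \<bar>y\<bar> powr 1 \<partial>M) \<le> C1 * ((1/\<bar>t\<bar>) powr (1 - \<alpha>) * h (1/\<bar>t\<bar>)) \<and>
        (\<gamma> / 2 * ((1/\<bar>t\<bar>) powr (-\<alpha>) * h (1/\<bar>t\<bar>)) \<le> tail (1/\<bar>t\<bar>) \<and>
        tail (1/\<bar>t\<bar>) \<le> 2 * \<gamma> * ((1/\<bar>t\<bar>) powr (-\<alpha>) * h (1/\<bar>t\<bar>)))"
      using eventually_at_top_inverse_abs[OF eventually_conj[OF C1 tail_bounds]] a1 by auto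
    show ?thesis
    proof (rule that[OF x0(1)])
      fix t :: real assume t: "t \<noteq> 0" "\<bar>t\<bar> \<le> 1 / x0"
      have "norm (char M t - 1) \<le> \<bar>t\<bar> * (\<integral>y. indicator {-(1/\<bar>t\<bar>)..1/\<bar>t\<bar>} y * \<bar>y\<bar> \<partial>M)
          + 2 * measure M (- {-(1/\<bar>t\<bar>)..1/\<bar>t\<bar>})"
        using t(1) by (rule norm_char_minus_1_le)
      also have "\<dots> \<le> \<bar>t\<bar> * (C1 * ((1/\<bar>t\<bar>) powr (1 - \<alpha>) * h (1/\<bar>t\<bar>)))
          + 2 * (2 * \<gamma> * ((1/\<bar>t\<bar>) powr (-\<alpha>) * h (1/\<bar>t\<bar>)))"
        using x0(2)[OF t] order_trans[OF measure_outside_le_tail[of "1/\<bar>t\<bar>"]]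
        by (intro add_mono mult_left_mono) auto
      also have "\<bar>t\<bar> * (C1 * ((1/\<bar>t\<bar>) powr (1 - \<alpha>) * h (1/\<bar>t\<bar>))) = C1 * (\<bar>t\<bar> powr \<alpha> * h (1/\<bar>t\<bar>))"
        using t(1) by (simp add: powr_divide powr_diff)
      also have "2 * (2 * \<gamma> * ((1/\<bar>t\<bar>) powr (-\<alpha>) * h (1/\<bar>t\<bar>))) = 4 * \<gamma> * (\<bar>t\<bar> powr \<alpha> * h (1/\<bar>t\<bar>))"
        using t(1) by (simp add: powr_divide powr_minus)
      finally show "norm (char M t - 1) \<le> (C1 + 4 * \<gamma>) * (\<bar>t\<bar> powr \<alpha> * h (1/\<bar>t\<bar>))"
        by (simp add: distrib_right)
    qed
  qed
qed

lemma norm_char_le_exp_h: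
  assumes "u \<noteq> v" "measure M {u} > 0" "measure M {v} > 0"
  obtains c x0 where "c > 0" "x0 > 0"
    "\<And>t. t \<noteq> 0 \<Longrightarrow> \<bar>t\<bar> \<le> 1 / x0 \<Longrightarrow> norm (char M t) \<le> exp (- (c * (\<bar>t\<bar> powr \<alpha> * h (1 / \<bar>t\<bar>))))"
proof -
  obtain c x0 where c: "c > 0" "x0 > 0"
    and le: "\<And>t. t \<noteq> 0 \<Longrightarrow> \<bar>t\<bar> \<le> 1 / x0 \<Longrightarrow> norm (char M t) \<le> exp (- (c * t\<^sup>2 * trunc_moment2 (1 / \<bar>t\<bar>)))"
    using norm_char_le_exp_trunc_moment2[OF assms] by blast
  obtain d where d: "d > 0" "\<forall>\<^sub>F x in at_top. d * (x powr (2 - \<alpha>) * h x) \<le> trunc_moment2 x"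
    by (rule trunc_moment2_ge)
  obtain x1 where x1: "x1 > 0" "\<And>t. t \<noteq> 0 \<Longrightarrow> \<bar>t\<bar> \<le> 1 / x1 \<Longrightarrow>
      d * ((1/\<bar>t\<bar>) powr (2 - \<alpha>) * h (1/\<bar>t\<bar>)) \<le> trunc_moment2 (1/\<bar>t\<bar>)"
    using eventually_at_top_inverse_abs[OF d(2)] by blast
  show ?thesis
  proof (rule that[of "c * d" "max x0 x1"])
    fix t :: real assume t: "t \<noteq> 0" "\<bar>t\<bar> \<le> 1 / max x0 x1"
    have t0: "\<bar>t\<bar> \<le> 1 / x0" "\<bar>t\<bar> \<le> 1 / x1"
      using t(2) c(2) x1(1) by (auto intro: order_trans[OF _ frac_le[of 1 1]])
    have "c * d * (\<bar>t\<bar> powr \<alpha> * h (1/\<bar>t\<bar>)) = c * t\<^sup>2 * (d * ((1/\<bar>t\<bar>) powr (2 - \<alpha>) * h (1/\<bar>t\<bar>)))"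
      using t(1) by (simp add: powr_divide powr_diff)
    also have "\<dots> \<le> c * t\<^sup>2 * trunc_moment2 (1/\<bar>t\<bar>)"
      using x1(2)[OF t(1) t0(2)] c by (intro mult_left_mono) auto
    finally show "norm (char M t) \<le> exp (- (c * d * (\<bar>t\<bar> powr \<alpha> * h (1 / \<bar>t\<bar>))))"
      using le[OF t(1) t0(1)] by (smt (verit) exp_le_cancel_iff)
  qed (use c d in \<open>auto simp: less_max_iff_disj\<close>)
qed

end

subsection \<open>Integral estimates for powers of the characteristic function\<close>

text \<open>Interpolates between the bounds |u| and 2. The choice of \<eta> here is the freedom in
  \<eta> of the theorem.\<close>

lemma norm_iexp_minus_1_le_powr:
  assumes "0 < \<eta>" "\<eta> \<le> 1"
  shows "norm (iexp u - 1) \<le> 2 * \<bar>u\<bar> powr \<eta>"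
proof (cases "\<bar>u\<bar> \<le> 1")
  case True
  have "norm (iexp u - 1) \<le> \<bar>u\<bar>" using iexp_approx1[of u 0] by simp
  also have "\<dots> \<le> \<bar>u\<bar> powr \<eta>"
    using powr_mono'[of \<eta> 1 "\<bar>u\<bar>"] assms True by simp
  also have "\<dots> \<le> 2 * \<bar>u\<bar> powr \<eta>" by simp
  finally show ?thesis .
next
  case False
  have "norm (iexp u - 1) \<le> 2 * 1" using iexp_approx2[of u 0] by simp
  also have "1 \<le> \<bar>u\<bar> powr \<eta>" using False assms by (intro ge_one_powr_ge_zero) auto
  finally show ?thesis by simp
qed

lemma integrable_indicator_Icc: "integrable lborel (indicator {a..b::real} :: real \<Rightarrow> real)"
  by (intro integrable_real_indicator) (auto simp: emeasure_lborel_Icc_eq)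

text \<open>The four summands come, in this order, from |t| > e, from the phase exp(i t k) - 1, from
  |1 - \<phi>^m| on |t| < \<tau>, and from the same quantity on \<tau> \<le> |t| \<le> e. With N = n
  - m, the last three become the rates of the theorem.\<close>

lemma (in real_distribution) integral_char_powers_diff_le:
  fixes h :: "real \<Rightarrow> real" and e \<alpha> \<eta> k c c' \<tau> A H :: real and m N :: nat
  assumes e: "0 < e" "e \<le> pi" and alpha: "0 < \<alpha>" and eta: "0 < \<eta>" "\<eta> \<le> 1"
    and c': "0 < c'" and A: "0 \<le> A" and H: "0 \<le> H" and \<tau>: "0 < \<tau>" and N: "0 < N"
    and away: "\<And>t. e \<le> \<bar>t\<bar> \<Longrightarrow> \<bar>t\<bar> \<le> pi \<Longrightarrow> norm (char M t) \<le> exp (- c)"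
    and decay: "\<And>t. t \<noteq> 0 \<Longrightarrow> \<bar>t\<bar> \<le> e \<Longrightarrow> norm (char M t) \<le> exp (- (c' * \<bar>t\<bar> powr \<alpha>))"
    and near1: "\<And>t. t \<noteq> 0 \<Longrightarrow> \<bar>t\<bar> \<le> e \<Longrightarrow> norm (char M t - 1) \<le> A * (\<bar>t\<bar> powr \<alpha> * h (1 / \<bar>t\<bar>))"
    and hH: "\<And>t. \<tau> \<le> \<bar>t\<bar> \<Longrightarrow> \<bar>t\<bar> \<le> e \<Longrightarrow> h (1 / \<bar>t\<bar>) \<le> H"
  shows "(\<integral>t. indicator {-pi..pi} t * (norm (char M t) ^ N * norm (iexp (t * k) - char M t ^ m)) \<partial>lborel)
    \<le> 4 * pi * exp (- c * real N)
      + 2 * \<bar>k\<bar> powr \<eta> * (\<integral>t. \<bar>t\<bar> powr \<eta> * exp (- (\<bar>t\<bar> powr \<alpha>)) \<partial>lborel) * (c' * real N) powr (- ((\<eta> + 1) / \<alpha>))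
      + 4 * real m * \<tau>
      + real m * A * H * (\<integral>t. \<bar>t\<bar> powr \<alpha> * exp (- (\<bar>t\<bar> powr \<alpha>)) \<partial>lborel) * (c' * real N) powr (- ((\<alpha> + 1) / \<alpha>))"
    (is "(\<integral>t. ?f t \<partial>lborel) \<le> ?rhs")
proof -
  define E where "E = (\<lambda>t::real. exp (- (c' * real N * \<bar>t\<bar> powr \<alpha>)))"
  define g where "g = (\<lambda>t::real. (2 * exp (- c * real N)) * indicator {-pi..pi} t
    + (2 * \<bar>k\<bar> powr \<eta>) * (\<bar>t\<bar> powr \<eta> * E t) + (2 * real m) * indicator {-\<tau>..\<tau>} t
    + (real m * A * H) * (\<bar>t\<bar> powr \<alpha> * E t))"
  have cN: "c' * real N > 0" using c' N by simp
  have i1: "integrable lborel (\<lambda>t. \<bar>t\<bar> powr \<eta> * E t)"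
    unfolding E_def using eta alpha cN by (intro powr_stretched_exp_scaled) auto
  have i2: "integrable lborel (\<lambda>t. \<bar>t\<bar> powr \<alpha> * E t)"
    unfolding E_def using alpha cN by (intro powr_stretched_exp_scaled) auto
  note ints = i1 i2 integrable_indicator_Icc
  have g0: "0 \<le> g t" for t
    unfolding g_def E_def using A H by (intro add_nonneg_nonneg mult_nonneg_nonneg) auto
  have "(\<integral>t. ?f t \<partial>lborel) \<le> (\<integral>t. g t \<partial>lborel)"
  proof (rule integral_mono_AE')
    show "integrable lborel g"
      unfolding g_def by (intro Bochner_Integration.integrable_add integrable_mult_right ints)
    show "AE t in lborel. 0 \<le> g t" using g0 by simp
    have "?f t \<le> g t" for t
    proof (cases "\<bar>t\<bar> \<le> pi \<and> t \<noteq> 0")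
      case False
      \<comment> \<open>The point 0, at which \<open>decay\<close> and \<open>near1\<close> say
        nothing, is harmless: phase and power are both 1 there.\<close>
      then have "?f t = 0" by (auto split: split_indicator simp: char_zero)
      then show ?thesis using g0[of t] by linarith
    next
      case True
      then have t: "\<bar>t\<bar> \<le> pi" "t \<noteq> 0" by auto
      then have ind: "indicator {-pi..pi} t = (1::real)" by (auto simp: abs_le_iff minus_le_iff)
      have norm1: "norm (char M t ^ j) \<le> 1" for j
        using cmod_char_le_1[of t] by (simp add: norm_power power_le_one)
      have E0: "E t \<ge> 0" by (simp add: E_def)
      show ?thesis
      proof (cases "\<bar>t\<bar> \<le> e")
        case False
        have "norm (char M t) ^ N \<le> exp (- c) ^ N"
          using away[of t] False t by (intro power_mono) auto
        moreover have "norm (iexp (t * k) - char M t ^ m) \<le> 2"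
          using norm_triangle_ineq4[of "iexp (t * k)" "char M t ^ m"] norm1[of m] by simp
        ultimately have "?f t \<le> 1 * (exp (- c) ^ N * 2)"
          unfolding ind by (intro mult_left_mono mult_mono) auto
        also have "\<dots> = 2 * exp (- c * real N) * indicator {-pi..pi} t"
          using ind by (simp add: exp_of_nat_mult[symmetric] mult.commute)
        also have "\<dots> \<le> g t"
          unfolding g_def using A H E0 by (simp add: add_increasing2)
        finally show ?thesis .
      next
        case True
        have d: "norm (char M t) ^ N \<le> E t"
        proof -
          have "norm (char M t) ^ N \<le> exp (- (c' * \<bar>t\<bar> powr \<alpha>)) ^ N"
            using decay[OF t(2) True] by (intro power_mono) auto
          also have "\<dots> = E t" by (simp add: E_def exp_of_nat_mult[symmetric] mult_ac)
          finally show ?thesis .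
        qed
        have E1: "E t \<le> 1" using c' by (simp add: E_def)
        have a: "norm (iexp (t * k) - 1) \<le> 2 * \<bar>k\<bar> powr \<eta> * \<bar>t\<bar> powr \<eta>"
          using norm_iexp_minus_1_le_powr[OF eta, of "t * k"] by (simp add: abs_mult powr_mult mult_ac)
        have b: "norm (char M t ^ m - 1) \<le> m * norm (char M t - 1)"
          using norm_power_diff[of "char M t" 1 m] cmod_char_le_1[of t] by simp
        have c: "E t * norm (char M t ^ m - 1)
            \<le> (2 * real m) * indicator {-\<tau>..\<tau>} t + (real m * A * H) * (\<bar>t\<bar> powr \<alpha> * E t)"
        \<comment> \<open>Below \<tau> only |\<phi> - 1| \<le> 2 is used; the resulting constant 2m
          integrates over [-\<tau>, \<tau>] to 4 m \<tau>.\<close>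
        proof (cases "\<bar>t\<bar> < \<tau>")
          case True
          have "norm (char M t - 1) \<le> 2"
            using norm_triangle_ineq4[of "char M t" 1] cmod_char_le_1[of t] by simp
          then have "m * norm (char M t - 1) \<le> real m * 2" by (intro mult_left_mono) auto
          then have "E t * norm (char M t ^ m - 1) \<le> 1 * (2 * real m)"
            using E0 E1 b by (intro mult_mono) auto
          moreover have "indicator {-\<tau>..\<tau>} t = (1::real)" using True by (auto simp: abs_less_iff)
          moreover have "0 \<le> (real m * A * H) * (\<bar>t\<bar> powr \<alpha> * E t)" using A H E0 by simp
          ultimately show ?thesis by simp
        next
          case False
          have "norm (char M t - 1) \<le> A * (\<bar>t\<bar> powr \<alpha> * h (1 / \<bar>t\<bar>))"
            using near1[OF t(2) True] .
          also have "\<dots> \<le> A * (\<bar>t\<bar> powr \<alpha> * H)"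
            using hH[of t] False True A by (intro mult_left_mono) auto
          finally have "m * norm (char M t - 1) \<le> m * (A * (\<bar>t\<bar> powr \<alpha> * H))"
            by (intro mult_left_mono) auto
          with b have "norm (char M t ^ m - 1) \<le> m * (A * (\<bar>t\<bar> powr \<alpha> * H))" by linarith
          then have "E t * norm (char M t ^ m - 1) \<le> E t * (m * (A * (\<bar>t\<bar> powr \<alpha> * H)))"
            using E0 by (intro mult_left_mono)
          also have "\<dots> = (real m * A * H) * (\<bar>t\<bar> powr \<alpha> * E t)" by (simp add: mult_ac)
          finally show ?thesis by (simp add: add_increasing)
        qed
        have "norm (iexp (t * k) - char M t ^ m) \<le> norm (iexp (t * k) - 1) + norm (char M t ^ m - 1)"
          using norm_triangle_ineq4[of "iexp (t * k) - 1" "char M t ^ m - 1"] by simp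
        then have "norm (char M t) ^ N * norm (iexp (t * k) - char M t ^ m)
            \<le> E t * (norm (iexp (t * k) - 1) + norm (char M t ^ m - 1))"
          using d E0 by (intro mult_mono) auto
        also have "\<dots> \<le> E t * (2 * \<bar>k\<bar> powr \<eta> * \<bar>t\<bar> powr \<eta>) + E t * norm (char M t ^ m - 1)"
          using a E0 by (simp add: distrib_left mult_left_mono)
        also have "\<dots> \<le> E t * (2 * \<bar>k\<bar> powr \<eta> * \<bar>t\<bar> powr \<eta>)
            + ((2 * real m) * indicator {-\<tau>..\<tau>} t + (real m * A * H) * (\<bar>t\<bar> powr \<alpha> * E t))"
          using c by simp
        also have "\<dots> \<le> g t" by (simp add: g_def mult_ac)
        finally show ?thesis using ind by simp
      qed
    qed
    then show "AE t in lborel. ?f t \<le> g t" by simp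
  qed
  also have "(\<integral>t. g t \<partial>lborel) = (2 * exp (- c * real N)) * (\<integral>t. indicator {-pi..pi} t \<partial>lborel)
    + (2 * \<bar>k\<bar> powr \<eta>) * (\<integral>t. \<bar>t\<bar> powr \<eta> * E t \<partial>lborel) + (2 * real m) * (\<integral>t. indicator {-\<tau>..\<tau>} t \<partial>lborel)
    + (real m * A * H) * (\<integral>t. \<bar>t\<bar> powr \<alpha> * E t \<partial>lborel)"
    unfolding g_def
    by (simp only: Bochner_Integration.integral_add integral_mult_right_zero ints
        Bochner_Integration.integrable_add integrable_mult_right)
  also have "\<dots> = ?rhs"
    using \<tau> powr_stretched_exp_scaled(2)[of \<eta> \<alpha> "c' * real N"] powr_stretched_exp_scaled(2)[of \<alpha> \<alpha> "c' * real N"]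
      eta alpha cN
    by (simp add: E_def)
  finally show ?thesis .
qed

text \<open>Bounding h below by a constant would give only the order m^(-1/\<alpha>) and lose L(m).
  Instead, for x0 \<le> 1/|t| \<le> b_m, the Potter-type bound and the equation for b_m give m
  |t|^\<alpha> h(1/|t|) \<ge> p (|t| b_m)^(\<alpha>/2). So near 0 the integrand is dominated by a
  function of |t| b_m alone, whose integral is of order 1/b_m. The equation is asked for only where
  h(b_m) > 0, as h need not be positive at small arguments.\<close>

lemma (in stable_attraction) integral_char_power_le:
  fixes b :: "nat \<Rightarrow> real"
  assumes atoms: "u \<noteq> v" "measure M {u} > 0" "measure M {v} > 0"
    and span: "\<And>a d. d > 1 \<Longrightarrow> \<not> (AE x in M. x \<in> lattice_pts a d)"
    and b_pos: "\<And>m. m \<ge> 1 \<Longrightarrow> 0 < b m"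
    and b_eq: "\<And>m. m \<ge> 1 \<Longrightarrow> 0 < h (b m) \<Longrightarrow> b m powr \<alpha> = m * h (b m)"
  obtains B where "\<And>m. m \<ge> 1 \<Longrightarrow> b m * (\<integral>t. indicator {-pi..pi} t * norm (char M t) ^ m \<partial>lborel) \<le> B"
proof -
  obtain c x1 where c: "c > 0" "x1 > 0"
    and dec: "\<And>t. t \<noteq> 0 \<Longrightarrow> \<bar>t\<bar> \<le> 1 / x1 \<Longrightarrow> norm (char M t) \<le> exp (- (c * (\<bar>t\<bar> powr \<alpha> * h (1 / \<bar>t\<bar>))))"
    using norm_char_le_exp_h[OF atoms] by blast
  obtain p x2 where p: "p > 0" "x2 > 0"
    and pot: "\<And>x y. x2 \<le> x \<Longrightarrow> x \<le> y \<Longrightarrow> p * (y powr (-(\<alpha>/2)) * h y) \<le> x powr (-(\<alpha>/2)) * h x"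
    by (rule h_potter) blast
  obtain x3 where x3: "\<And>x. x \<ge> x3 \<Longrightarrow> 0 < h x"
    using h_pos unfolding eventually_at_top_linorder by blast
  define x0 where "x0 = max (max x1 x2) x3"
  have x0: "x1 \<le> x0" "x2 \<le> x0" "x3 \<le> x0" "0 < x0" using c by (auto simp: x0_def less_max_iff_disj)
  obtain d where d: "d > 0" and away: "\<And>t. 1 / x0 \<le> \<bar>t\<bar> \<Longrightarrow> \<bar>t\<bar> \<le> pi \<Longrightarrow> norm (char M t) \<le> exp (- d)"
    using norm_char_bounded_away[OF span, of "1 / x0"] x0 by auto
  \<comment> \<open>r \<le> 1 serves |t| b_m < 1, where the trivial bound 1 is dominated with the
    help of the factor e; r \<le> c p serves the rest. s is r moved inside the power
    \<alpha>/2.\<close>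
  define r where "r = min 1 (c * p)"
  define s where "s = r powr (2 / \<alpha>)"
  have r: "0 < r" "r \<le> 1" "r \<le> c * p" using c p by (auto simp: r_def)
  have s: "s > 0" using r by (simp add: s_def)
  define J where "J = (\<integral>t. exp (- (\<bar>t\<bar> powr (\<alpha>/2))) \<partial>lborel)"
  have near: "norm (char M t) ^ m \<le> exp 1 * exp (- ((s * b m * \<bar>t\<bar>) powr (\<alpha>/2)))"
    if m: "m \<ge> 1" and t: "\<bar>t\<bar> \<le> 1 / x0" for m t
  proof -
    have sb: "(s * b m * \<bar>t\<bar>) powr (\<alpha>/2) = r * (\<bar>t\<bar> * b m) powr (\<alpha>/2)"
      using s r b_pos[OF m] alpha by (simp add: s_def powr_mult powr_powr mult_ac)
    show ?thesis
    proof (cases "\<bar>t\<bar> * b m < 1")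
      case True
      have "norm (char M t) ^ m \<le> 1" using cmod_char_le_1[of t] by (simp add: power_le_one)
      also have "1 \<le> exp (1 - r * (\<bar>t\<bar> * b m) powr (\<alpha>/2))"
      proof -
        have "(\<bar>t\<bar> * b m) powr (\<alpha>/2) \<le> 1"
          using True alpha b_pos[OF m] by (intro powr_le1) auto
        then have "r * (\<bar>t\<bar> * b m) powr (\<alpha>/2) \<le> 1 * 1" using r by (intro mult_mono) auto
        then show ?thesis by simp
      qed
      finally show ?thesis unfolding sb by (simp add: exp_add[symmetric])
    next
      case False
      then have t0: "t \<noteq> 0" by auto
      have bt: "x0 \<le> 1 / \<bar>t\<bar>" "1 / \<bar>t\<bar> \<le> b m"
        using t False t0 x0 by (auto simp: field_simps)
      have hb: "0 < h (b m)" using bt x0 by (intro x3) linarith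
      have "1 / x0 \<le> 1 / x1" using x0 c by (intro divide_left_mono) auto
      then have "norm (char M t) ^ m \<le> exp (- (c * (\<bar>t\<bar> powr \<alpha> * h (1 / \<bar>t\<bar>)))) ^ m"
        using dec[OF t0] t by (intro power_mono) auto
      also have "\<dots> = exp (- (c * (m * (\<bar>t\<bar> powr \<alpha> * h (1 / \<bar>t\<bar>)))))"
        by (simp add: exp_of_nat_mult[symmetric] mult_ac)
      also have "\<dots> \<le> exp (- (r * (\<bar>t\<bar> * b m) powr (\<alpha>/2)))"
      proof -
        have "p * (b m powr (-(\<alpha>/2)) * h (b m)) \<le> (1 / \<bar>t\<bar>) powr (-(\<alpha>/2)) * h (1 / \<bar>t\<bar>)"
          using bt x0 by (intro pot) auto
        then have "\<bar>t\<bar> powr (\<alpha>/2) * (m * (p * (b m powr (-(\<alpha>/2)) * h (b m))))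
            \<le> \<bar>t\<bar> powr (\<alpha>/2) * (m * ((1 / \<bar>t\<bar>) powr (-(\<alpha>/2)) * h (1 / \<bar>t\<bar>)))"
          by (intro mult_left_mono) auto
        moreover have "\<bar>t\<bar> powr (\<alpha>/2) * (m * ((1 / \<bar>t\<bar>) powr (-(\<alpha>/2)) * h (1 / \<bar>t\<bar>)))
            = m * (\<bar>t\<bar> powr \<alpha> * h (1 / \<bar>t\<bar>))"
          using t0 by (simp add: powr_divide powr_minus powr_add[symmetric])
        moreover have "\<bar>t\<bar> powr (\<alpha>/2) * (m * (p * (b m powr (-(\<alpha>/2)) * h (b m))))
            = p * (\<bar>t\<bar> * b m) powr (\<alpha>/2)"
        proof -
          have "m * (b m powr (-(\<alpha>/2)) * h (b m)) = b m powr (-(\<alpha>/2)) * b m powr \<alpha>"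
            using b_eq[OF m hb] by simp
          also have "\<dots> = b m powr (\<alpha>/2)" by (simp add: powr_add[symmetric])
          finally have "m * (b m powr (-(\<alpha>/2)) * h (b m)) = b m powr (\<alpha>/2)" .
          then show ?thesis using b_pos[OF m] by (simp add: powr_mult mult_ac)
        qed
        ultimately have "p * (\<bar>t\<bar> * b m) powr (\<alpha>/2) \<le> m * (\<bar>t\<bar> powr \<alpha> * h (1 / \<bar>t\<bar>))" by simp
        then have "c * (p * (\<bar>t\<bar> * b m) powr (\<alpha>/2)) \<le> c * (m * (\<bar>t\<bar> powr \<alpha> * h (1 / \<bar>t\<bar>)))"
          using c by (intro mult_left_mono) auto
        moreover have "r * (\<bar>t\<bar> * b m) powr (\<alpha>/2) \<le> c * p * (\<bar>t\<bar> * b m) powr (\<alpha>/2)"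
          using r by (intro mult_right_mono) auto
        ultimately show ?thesis by (simp add: mult.assoc)
      qed
      also have "\<dots> \<le> exp 1 * exp (- (r * (\<bar>t\<bar> * b m) powr (\<alpha>/2)))" by simp
      finally show ?thesis unfolding sb .
    qed
  qed
  \<comment> \<open>Away from 0 the integrand decays exponentially in m, so b_m only needs
    polynomial growth: when b_m exceeds x0, the Potter-type bound between x0 and b_m gives
    (b_m)^(\<alpha>/2) \<le> m Q.\<close>
  obtain B1 where B1: "\<And>m. m \<ge> 1 \<Longrightarrow> b m * exp (- d * real m) \<le> B1"
  proof -
    obtain B where B: "\<And>u. u \<ge> 0 \<Longrightarrow> u powr (2/\<alpha>) * exp (- (u powr 1)) \<le> B"
      using powr_stretched_exp_bounded[of "2/\<alpha>" 1] alpha by auto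
    define Q where "Q = x0 powr (-(\<alpha>/2)) * h x0 / p"
    have Q: "Q > 0" using x0 p x3[of x0] by (simp add: Q_def)
    have "b m * exp (- d * real m) \<le> max x0 ((Q / d) powr (2/\<alpha>) * B)" if m: "m \<ge> 1" for m
    proof (cases "b m \<le> x0")
      case True
      have "exp (- d * real m) \<le> 1" using d by simp
      then have "b m * exp (- d * real m) \<le> x0 * 1"
        using True b_pos[OF m] by (intro mult_mono) auto
      then show ?thesis by simp
    next
      case False
      have hb: "0 < h (b m)" using False x0 by (intro x3) linarith
      have "p * (b m powr (-(\<alpha>/2)) * h (b m)) \<le> x0 powr (-(\<alpha>/2)) * h x0"
        using False x0 by (intro pot) auto
      then have "b m powr (-(\<alpha>/2)) * h (b m) \<le> Q" using p by (simp add: Q_def field_simps)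
      then have "m * (b m powr (-(\<alpha>/2)) * h (b m)) \<le> m * Q" by (intro mult_left_mono) auto
      also have "m * (b m powr (-(\<alpha>/2)) * h (b m)) = b m powr (-(\<alpha>/2)) * b m powr \<alpha>"
        using b_eq[OF m hb] by simp
      also have "\<dots> = b m powr (\<alpha>/2)" by (simp add: powr_add[symmetric])
      finally have "(b m powr (\<alpha>/2)) powr (2/\<alpha>) \<le> (m * Q) powr (2/\<alpha>)"
        using alpha by (intro powr_mono2) auto
      then have "b m \<le> (m * Q) powr (2/\<alpha>)"
        using b_pos[OF m] alpha by (simp add: powr_powr)
      also have "\<dots> = (Q / d) powr (2/\<alpha>) * (d * m) powr (2/\<alpha>)"
        using d Q by (simp add: powr_mult[symmetric] mult.commute)
      finally have "b m * exp (- d * real m) \<le> (Q / d) powr (2/\<alpha>) * (d * m) powr (2/\<alpha>) * exp (- d * real m)"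
        by (intro mult_right_mono) auto
      also have "\<dots> = (Q / d) powr (2/\<alpha>) * ((d * m) powr (2/\<alpha>) * exp (- ((d * m) powr 1)))"
        using d by simp
      also have "\<dots> \<le> (Q / d) powr (2/\<alpha>) * B" using B[of "d * m"] d by (intro mult_left_mono) auto
      finally show ?thesis by simp
    qed
    then show ?thesis by (rule that)
  qed
  have "b m * (\<integral>t. indicator {-pi..pi} t * norm (char M t) ^ m \<partial>lborel) \<le> 2 * pi * B1 + exp 1 * J / s"
    if m: "m \<ge> 1" for m
  proof -
    have sb: "s * b m > 0" using s b_pos[OF m] by simp
    let ?E = "\<lambda>t. exp (- ((s * b m * \<bar>t\<bar>) powr (\<alpha>/2)))"
    have i: "integrable lborel ?E" using alpha sb by (intro stretched_exp_scaled) auto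
    have "(\<integral>t. indicator {-pi..pi} t * norm (char M t) ^ m \<partial>lborel)
        \<le> (\<integral>t. exp (- d * m) * indicator {-pi..pi} t + exp 1 * ?E t \<partial>lborel)"
    proof (rule integral_mono_AE')
      show "integrable lborel (\<lambda>t. exp (- d * m) * indicator {-pi..pi} t + exp 1 * ?E t)"
        by (intro Bochner_Integration.integrable_add integrable_mult_right integrable_indicator_Icc i)
      have "indicator {-pi..pi} t * norm (char M t) ^ m \<le> exp (- d * m) * indicator {-pi..pi} t + exp 1 * ?E t" for t
      proof (cases "\<bar>t\<bar> \<le> 1 / x0")
        case True
        have "indicator {-pi..pi} t * norm (char M t) ^ m \<le> 1 * norm (char M t) ^ m"
          by (intro mult_right_mono) (auto split: split_indicator)
        also have "\<dots> \<le> exp 1 * ?E t" using near[OF m True] by simp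
        finally show ?thesis by (simp add: add_increasing)
      next
        case False
        show ?thesis
        proof (cases "t \<in> {-pi..pi}")
          case True
          then have "norm (char M t) ^ m \<le> exp (- d) ^ m"
            using False away[of t] by (intro power_mono) auto
          also have "\<dots> = exp (- d * m)" by (simp add: exp_of_nat_mult[symmetric] mult_ac)
          finally show ?thesis using True by (simp add: add_increasing2)
        qed simp
      qed
      then show "AE t in lborel. indicator {-pi..pi} t * norm (char M t) ^ m
          \<le> exp (- d * m) * indicator {-pi..pi} t + exp 1 * ?E t" by simp
    qed auto
    also have "\<dots> = exp (- d * m) * (2 * pi) + exp 1 * (J / (s * b m))"
      using i stretched_exp_scaled(2)[of "\<alpha>/2" "s * b m"] alpha sb
      by (subst Bochner_Integration.integral_add) (auto simp: J_def integrable_indicator_Icc)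
    finally have "b m * (\<integral>t. indicator {-pi..pi} t * norm (char M t) ^ m \<partial>lborel)
        \<le> b m * (exp (- d * m) * (2 * pi) + exp 1 * (J / (s * b m)))"
      using b_pos[OF m] by (intro mult_left_mono) auto
    also have "\<dots> = 2 * pi * (b m * exp (- d * m)) + exp 1 * J / s"
      using b_pos[OF m] s by (simp add: field_simps)
    also have "\<dots> \<le> 2 * pi * B1 + exp 1 * J / s"
      using B1[OF m] by (intro add_right_mono mult_left_mono) auto
    finally show ?thesis .
  qed
  then show ?thesis by (rule that)
qed

subsection \<open>Local probabilities of lattice sums\<close>

text \<open>Each law is inverted with the phase of its own point, so the two lattices may differ. It
  is meant for the increment at \<kappa>_n - \<kappa>_m and for S_n at \<kappa>_n; their shift
  reappears as the factor exp(i t \<kappa>_m).\<close>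

lemma lattice_local_prob_diff_le:
  assumes \<mu>: "real_distribution \<mu>" "AE x in \<mu>. x - y \<in> \<int>"
    and \<nu>: "real_distribution \<nu>" "AE x in \<nu>. x - z \<in> \<int>"
  shows "\<bar>measure \<mu> {y} - measure \<nu> {z}\<bar> \<le>
    (\<integral>t. indicator {-pi..pi} t * norm (iexp (- (t * y)) * char \<mu> t - iexp (- (t * z)) * char \<nu> t) \<partial>lborel) / (2 * pi)"
proof -
  note inv1 = real_distribution.lattice_inversion[OF \<mu>]
  note inv2 = real_distribution.lattice_inversion[OF \<nu>]
  have "complex_of_real (measure \<mu> {y} - measure \<nu> {z}) =
    (CLBINT t. indicator {-pi..pi} t *\<^sub>R (iexp (- (t * y)) * char \<mu> t - iexp (- (t * z)) * char \<nu> t)) / (2 * pi)"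
    unfolding of_real_diff inv1(2) inv2(2)
    using inv1(1) inv2(1)
    by (simp only: diff_divide_distrib[symmetric] scaleR_diff_right Bochner_Integration.integral_diff)
  then have "\<bar>measure \<mu> {y} - measure \<nu> {z}\<bar> =
    norm (CLBINT t. indicator {-pi..pi} t *\<^sub>R (iexp (- (t * y)) * char \<mu> t - iexp (- (t * z)) * char \<nu> t)) / (2 * pi)"
    by (metis (no_types, lifting) norm_of_real norm_divide abs_of_pos of_real_mult of_real_numeral
        pi_gt_zero zero_less_mult_iff zero_less_numeral)
  also have "\<dots> \<le> (\<integral>t. norm (indicator {-pi..pi} t *\<^sub>R
      (iexp (- (t * y)) * char \<mu> t - iexp (- (t * z)) * char \<nu> t)) \<partial>lborel) / (2 * pi)"
    by (intro divide_right_mono integral_norm_bound) auto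
  finally show ?thesis by simp
qed

lemma lattice_local_prob_le:
  assumes \<mu>: "real_distribution \<mu>" "AE x in \<mu>. x - y \<in> \<int>"
  shows "measure \<mu> {y} \<le> (\<integral>t. indicator {-pi..pi} t * norm (char \<mu> t) \<partial>lborel) / (2 * pi)"
proof -
  note inv = real_distribution.lattice_inversion[OF \<mu>]
  have "measure \<mu> {y} = norm (complex_of_real (measure \<mu> {y}))" by simp
  also have "\<dots> = norm (CLBINT t. indicator {-pi..pi} t *\<^sub>R (iexp (- (t * y)) * char \<mu> t)) / (2 * pi)"
    unfolding inv(2) by (simp add: norm_divide norm_mult)
  also have "\<dots> \<le> (\<integral>t. norm (indicator {-pi..pi} t *\<^sub>R (iexp (- (t * y)) * char \<mu> t)) \<partial>lborel) / (2 * pi)"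
    by (intro divide_right_mono integral_norm_bound) auto
  finally show ?thesis by (simp add: norm_mult)
qed

lemma sum_minus_lattice_pt_in_Ints:
  assumes "finite I" and x: "\<And>i. i \<in> I \<Longrightarrow> x i \<in> lattice_pts a 1"
    and y: "y \<in> lattice_pts (real (card I) * a) 1"
  shows "(\<Sum>i\<in>I. x i) - y \<in> \<int>"
proof -
  have "x i - a \<in> \<int>" if "i \<in> I" for i
    using x[OF that] by (auto simp: lattice_pts_def)
  then have "(\<Sum>i\<in>I. x i - a) \<in> \<int>" by (rule Ints_sum)
  moreover have "y - real (card I) * a \<in> \<int>" using y by (auto simp: lattice_pts_def)
  ultimately have "(\<Sum>i\<in>I. x i - a) - (y - real (card I) * a) \<in> \<int>" by (rule Ints_diff)
  then show ?thesis by (simp add: sum_subtractf)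
qed

section \<open>Atoms of a lattice law\<close>

lemma countable_lattice_pts: "countable (lattice_pts a d)"
proof -
  have "lattice_pts a d = range (\<lambda>k::int. a + d * of_int k)" by (auto simp: lattice_pts_def)
  then show ?thesis by simp
qed

lemma (in real_distribution) ex_atom_in_countable:
  assumes A: "countable A" and pos: "measure M A > 0"
  shows "\<exists>x\<in>A. measure M {x} > 0"
proof (rule ccontr)
  assume "\<not> ?thesis"
  then have "{x} \<in> null_sets M" if "x \<in> A" for x
    using that by (auto simp: null_sets_def emeasure_eq_measure zero_less_measure_iff)
  then have "(\<Union>x\<in>A. {x}) \<in> null_sets M" using A by (intro null_sets_UN') auto
  then have "measure M A = 0" by (simp add: null_sets_def measure_def)
  then show False using pos by simp
qed

text \<open>A law carried by the single atom u would also live on u + 2Z, against the maximal span.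
  The two atoms are the nondegeneracy behind the lower bound on centred second moments.\<close>

lemma (in real_distribution) lattice_two_atoms:
  assumes lat: "AE x in M. x \<in> lattice_pts a 1"
    and span: "\<And>a d. d > 1 \<Longrightarrow> \<not> (AE x in M. x \<in> lattice_pts a d)"
  obtains u v where "u \<noteq> v" "measure M {u} > 0" "measure M {v} > 0"
proof -
  have sets: "A \<in> sets M" if "countable A" for A
    by (rule sets.countable[OF _ that]) simp
  let ?A = "lattice_pts a 1"
  have "measure M ?A = 1"
    using lat sets[OF countable_lattice_pts] by (simp add: prob_eq_1)
  then obtain u where u: "measure M {u} > 0"
    using ex_atom_in_countable[OF countable_lattice_pts, of a 1] by auto
  have "measure M (?A - {u}) > 0"
  proof (rule ccontr)
    assume "\<not> ?thesis"
    then have "measure M (?A - {u}) = 0" by (simp add: zero_less_measure_iff)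
    then have "?A - {u} \<in> null_sets M"
      using sets[OF countable_Diff[OF countable_lattice_pts]]
      by (auto simp: null_sets_def emeasure_eq_measure)
    then have "AE x in M. x \<notin> ?A - {u}" by (rule AE_not_in)
    with lat have "AE x in M. x \<in> lattice_pts u 2"
    proof eventually_elim
      case (elim x)
      then have "x = u + 2 * of_int 0" by auto
      then show ?case unfolding lattice_pts_def by blast
    qed
    then show False using span[of 2 u] by simp
  qed
  then obtain v where "v \<in> ?A - {u}" "measure M {v} > 0"
    using ex_atom_in_countable[of "?A - {u}"] countable_lattice_pts by blast
  then show ?thesis using that[of u v] u by auto
qed

text \<open>With x = m and y = n, the factor y^(1/\<alpha>) is b_n/L(n). The powers of m, n and n -
  m coming out of the integrals are rewritten in terms of m/n; the third identity handles the cutoff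
  near t = 0.\<close>

lemma rate_identities:
  fixes x y \<alpha> \<eta> :: real
  assumes "0 < x" "x < y" "0 < \<alpha>"
  shows "y powr (1/\<alpha>) * (x powr (\<eta>/\<alpha>) * (y - x) powr (- ((\<eta> + 1) / \<alpha>)))
      = (x / y) powr (\<eta>/\<alpha>) / (1 - x / y) powr ((\<eta> + 1) / \<alpha>)"
    and "y powr (1/\<alpha>) * (x * (y - x) powr (- ((\<alpha> + 1) / \<alpha>))) = (x / y) / (1 - x / y) powr (1 + 1/\<alpha>)"
    and "y powr (1/\<alpha>) * (x * y powr (- (1 + 1/\<alpha>))) = x / y"
proof -
  have d: "1 - x / y = (y - x) / y" using assms by (simp add: field_simps)
  have y: "y powr ((\<eta> + 1) / \<alpha>) = y powr (\<eta>/\<alpha>) * y powr (1/\<alpha>)"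
    by (simp add: powr_add[symmetric] add_divide_distrib)
  have y1: "y powr (1 + 1/\<alpha>) = y * y powr (1/\<alpha>)" using assms by (simp add: powr_add)
  have a: "(\<alpha> + 1) / \<alpha> = 1 + 1/\<alpha>" using assms by (simp add: add_divide_distrib)
  have gen: "A * (X * inverse Z) = (X / P) / (Z / (P * A))" if "A \<noteq> 0" "P \<noteq> 0" for A P X Z :: real
    using that by (simp add: divide_inverse)
  have pd: "((y - x) / y) powr p = (y - x) powr p / y powr p" "(x / y) powr p = x powr p / y powr p" for p
    using assms by (auto intro: powr_divide)
  have pos: "y powr p \<noteq> 0" "y \<noteq> 0" for p using assms by auto
  show "y powr (1/\<alpha>) * (x powr (\<eta>/\<alpha>) * (y - x) powr (- ((\<eta> + 1) / \<alpha>)))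
      = (x / y) powr (\<eta>/\<alpha>) / (1 - x / y) powr ((\<eta> + 1) / \<alpha>)"
    unfolding d powr_minus pd y by (rule gen[OF pos(1) pos(1)])
  show "y powr (1/\<alpha>) * (x * (y - x) powr (- ((\<alpha> + 1) / \<alpha>))) = (x / y) / (1 - x / y) powr (1 + 1/\<alpha>)"
    unfolding d a powr_minus pd y1 by (rule gen[OF pos])
  show "y powr (1/\<alpha>) * (x * y powr (- (1 + 1/\<alpha>))) = x / y"
    unfolding powr_minus y1 using pos by (simp add: divide_inverse)
qed

section \<open>Sums of independent copies and the final estimate\<close>

lemma (in prob_space) char_distr_iid_sum:
  assumes "indep_vars (\<lambda>_. borel) X UNIV" "\<And>i. distr M borel (X i) = \<mu>"
  shows "char (distr M borel (\<lambda>\<omega>. \<Sum>i\<in>I. X i \<omega>)) t = char \<mu> t ^ card I"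
  using char_distr_sum[OF indep_vars_subset[OF assms(1)], of I t] assms(2) by simp

lemma (in prob_space) prob_eq_and_sum_eq:
  fixes X :: "nat \<Rightarrow> 'a \<Rightarrow> real"
  assumes indep: "indep_vars (\<lambda>_. borel) X UNIV" and "m \<le> n"
  shows "prob {\<omega>\<in>space M. (\<Sum>i<m. X i \<omega>) = x \<and> (\<Sum>i<n. X i \<omega>) = y}
    = prob {\<omega>\<in>space M. (\<Sum>i<m. X i \<omega>) = x} * prob {\<omega>\<in>space M. (\<Sum>i\<in>{m..<n}. X i \<omega>) = y - x}"
proof -
  have split: "(\<Sum>i<n. X i \<omega>) = (\<Sum>i<m. X i \<omega>) + (\<Sum>i\<in>{m..<n}. X i \<omega>)" for \<omega>
    using \<open>m \<le> n\<close> by (simp add: lessThan_atLeast0 sum.atLeastLessThan_concat)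
  have "indep_var
      borel ((\<lambda>f. \<Sum>i<m. f i) \<circ> (\<lambda>\<omega>. restrict (\<lambda>i. X i \<omega>) {..<m}))
      borel ((\<lambda>f. \<Sum>i\<in>{m..<n}. f i) \<circ> (\<lambda>\<omega>. restrict (\<lambda>i. X i \<omega>) {m..<n}))"
    by (intro indep_var_compose[OF indep_var_restrict[OF indep]]) auto
  also have "((\<lambda>f. \<Sum>i<m. f i) \<circ> (\<lambda>\<omega>. restrict (\<lambda>i. X i \<omega>) {..<m})) = (\<lambda>\<omega>. \<Sum>i<m. X i \<omega>)"
    by auto
  also have "((\<lambda>f. \<Sum>i\<in>{m..<n}. f i) \<circ> (\<lambda>\<omega>. restrict (\<lambda>i. X i \<omega>) {m..<n})) = (\<lambda>\<omega>. \<Sum>i\<in>{m..<n}. X i \<omega>)"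
    by auto
  finally have "prob ((\<lambda>\<omega>. (\<Sum>i<m. X i \<omega>, \<Sum>i\<in>{m..<n}. X i \<omega>)) -` ({x} \<times> {y - x}) \<inter> space M)
      = prob ((\<lambda>\<omega>. \<Sum>i<m. X i \<omega>) -` {x} \<inter> space M) * prob ((\<lambda>\<omega>. \<Sum>i\<in>{m..<n}. X i \<omega>) -` {y - x} \<inter> space M)"
    by (rule indep_varD) auto
  moreover have "(\<lambda>\<omega>. (\<Sum>i<m. X i \<omega>, \<Sum>i\<in>{m..<n}. X i \<omega>)) -` ({x} \<times> {y - x}) \<inter> space M
      = {\<omega>\<in>space M. (\<Sum>i<m. X i \<omega>) = x \<and> (\<Sum>i<n. X i \<omega>) = y}"
    unfolding split by auto
  moreover have "f -` {z} \<inter> space M = {\<omega>\<in>space M. f \<omega> = z}" for f :: "'a \<Rightarrow> real" and z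
    by auto
  ultimately show ?thesis by simp
qed

theorem theorem3p1:
  fixes M :: "'a measure"
    and X :: "nat \<Rightarrow> 'a \<Rightarrow> real"
    and \<alpha> c1 c2 a \<kappa>0 :: real
    and l h :: "real \<Rightarrow> real"
    and b L \<kappa> :: "nat \<Rightarrow> real"
  defines "S \<equiv> (\<lambda>n \<omega>. \<Sum>i<n. X i \<omega>)"
  assumes prob: "prob_space M"
    and meas: "\<And>i. X i \<in> borel_measurable M"
    and indep: "prob_space.indep_vars M (\<lambda>_. borel) X UNIV"
    and ident: "\<And>i. distr M borel (X i) = distr M borel (X 0)"
    and lattice: "measure M {\<omega>\<in>space M. X 0 \<omega> \<in> lattice_pts a 1} = 1"
    and maxspan: "\<And>a' d. d > 1 \<Longrightarrow> measure M {\<omega>\<in>space M. X 0 \<omega> \<in> lattice_pts a' d} \<noteq> 1"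
    and alpha: "0 < \<alpha>" "\<alpha> \<le> 2" "\<alpha> \<noteq> 1"
    and cs: "c1 \<ge> 0" "c2 \<ge> 0" "c1 + c2 > 0"
    and l_sv: "slowly_varying l"
    and tail_r: "((\<lambda>x. x powr \<alpha> * measure M {\<omega>\<in>space M. X 0 \<omega> > x} / l x) \<longlongrightarrow> c1) at_top"
    and tail_l: "((\<lambda>x. x powr \<alpha> * measure M {\<omega>\<in>space M. X 0 \<omega> \<le> - x} / l x) \<longlongrightarrow> c2) at_top"
    and mean0: "\<alpha> > 1 \<Longrightarrow> integrable M (X 0) \<and> integral\<^sup>L M (X 0) = 0"
    and h_sv: "slowly_varying h"
    and h_lt2: "\<alpha> < 2 \<Longrightarrow> h \<sim>[at_top] l"
    and h_eq2: "\<alpha> = 2 \<Longrightarrow>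
       h \<sim>[at_top] (\<lambda>x. integral\<^sup>L M (\<lambda>\<omega>. if \<bar>X 0 \<omega>\<bar> \<le> x then (X 0 \<omega>)\<^sup>2 else 0))"
    and h_cont: "\<exists>a0>0. continuous_on {a0..} h"
    and b_pos: "\<And>n. n \<ge> 1 \<Longrightarrow> b n > 0"
    and b_def: "\<And>n. n \<ge> 1 \<Longrightarrow> b n = L n * real n powr (1 / \<alpha>)"
    and L_def: "\<And>n. n \<ge> 1 \<Longrightarrow> L n = h (b n) powr (1 / \<alpha>)"
    and L_sv: "\<exists>L'. slowly_varying L' \<and> (\<forall>n. L n = L' (real n))"
    and kappa_lat: "\<And>n. \<kappa> n \<in> lattice_pts (real n * a) 1"
    and kappa_lim: "(\<lambda>n. \<kappa> n / b n) \<longlonglongrightarrow> \<kappa>0"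
    and liminf_h: "Liminf at_top (\<lambda>x. ereal (h x)) > 0"
  shows "\<exists>\<epsilon>>0. \<exists>c>0.
     (\<forall>x\<ge>1/\<epsilon>. bdd_above (h ` {1/\<epsilon>..x})) \<and>
     (\<forall>\<eta>. 0 < \<eta> \<and> \<eta> \<le> 1 \<longrightarrow>
        (\<exists>C. \<forall>m n::nat. m \<ge> 1 \<and> real n > real m + \<epsilon> powr (- \<alpha> / (\<alpha> + 1)) \<longrightarrow>
           b m * b n *
             \<bar>measure M {\<omega>\<in>space M. S m \<omega> = \<kappa> m \<and> S n \<omega> = \<kappa> n}
              - measure M {\<omega>\<in>space M. S m \<omega> = \<kappa> m} * measure M {\<omega>\<in>space M. S n \<omega> = \<kappa> n}\<bar>
           \<le> C * L n *
             (real n powr (1 / \<alpha>) * (exp (- (real (n - m)) * c) + exp (- real n * c))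
              + (real m / real n) / (1 - real m / real n) powr (1 + 1 / \<alpha>)
                  * (1 + Sup (h ` {1/\<epsilon>..real n powr (1 + 1 / \<alpha>)}))
              + (real m / real n) powr (\<eta> / \<alpha>) * L m powr \<eta>
                  / (1 - real m / real n) powr ((\<eta> + 1) / \<alpha>))))"
proof -
  interpret prob_space M by (rule prob)
  define \<mu> where "\<mu> = distr M borel (X 0)"
  have [measurable]: "random_variable borel (X i)" for i by (rule meas)
  interpret \<mu>: real_distribution \<mu> unfolding \<mu>_def by simp
  have dist: "distr M borel (X i) = \<mu>" for i unfolding \<mu>_def by (rule ident)
  have AE_\<mu>: "(AE x in \<mu>. x \<in> lattice_pts a' d) \<longleftrightarrow> measure M {\<omega>\<in>space M. X 0 \<omega> \<in> lattice_pts a' d} = 1" for a' d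
  proof -
    have [measurable]: "lattice_pts a' d \<in> sets borel"
      by (rule sets.countable[OF _ countable_lattice_pts]) simp
    show ?thesis
      unfolding \<mu>_def by (subst AE_distr_iff) (simp_all add: prob_Collect_eq_1)
  qed
  have span: "\<not> (AE x in \<mu>. x \<in> lattice_pts a' d)" if "d > 1" for a' d
    using maxspan[OF that] AE_\<mu> by simp
  have lat: "AE x in \<mu>. x \<in> lattice_pts a 1" using lattice AE_\<mu> by simp
  have h_low: "\<exists>c>0. \<forall>\<^sub>F x in at_top. c \<le> h x"
  proof -
    obtain r where r: "0 < ereal r" "ereal r < Liminf at_top (\<lambda>x. ereal (h x))"
      using ereal_dense2[OF liminf_h] by auto
    have "\<forall>\<^sub>F x in at_top. r \<le> h x"
      using less_LiminfD[OF r(2)] by eventually_elim simp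
    then show ?thesis using r(1) by auto
  qed
  \<comment> \<open>Asymptotic equivalence counts 0/0 as 1; once h is nonzero it becomes convergence
    of the quotient to 1.\<close>
  then have h_ne: "\<forall>\<^sub>F x in at_top. h x \<noteq> 0" by (auto elim: eventually_mono)
  interpret SA: stable_attraction \<mu> \<alpha> "c1 + c2" h
  proof
    show "((\<lambda>x. h (2 * x) / h x) \<longlongrightarrow> 1) at_top"
      using h_sv unfolding slowly_varying_def by simp
    show "((\<lambda>x. x powr \<alpha> * (measure \<mu> {x<..} + measure \<mu> {..-x}) / h x) \<longlongrightarrow> c1 + c2) at_top" if "\<alpha> < 2"
    proof -
      have lh: "((\<lambda>x. l x / h x) \<longlongrightarrow> 1) at_top"
        by (rule asymp_equivD_strong[OF asymp_equiv_symI[OF h_lt2[OF that]]])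
           (use h_ne in \<open>eventually_elim, simp\<close>)
      have "((\<lambda>x. (x powr \<alpha> * measure M {\<omega>\<in>space M. X 0 \<omega> > x} / l x
          + x powr \<alpha> * measure M {\<omega>\<in>space M. X 0 \<omega> \<le> - x} / l x) * (l x / h x)) \<longlongrightarrow> (c1 + c2) * 1) at_top"
        by (intro tendsto_intros tail_r tail_l lh)
      moreover have "\<forall>\<^sub>F x in at_top. (x powr \<alpha> * measure M {\<omega>\<in>space M. X 0 \<omega> > x} / l x
          + x powr \<alpha> * measure M {\<omega>\<in>space M. X 0 \<omega> \<le> - x} / l x) * (l x / h x)
          = x powr \<alpha> * (measure \<mu> {x<..} + measure \<mu> {..-x}) / h x"
      proof -
        have "measure \<mu> {x<..} = measure M {\<omega>\<in>space M. X 0 \<omega> > x}"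
          "measure \<mu> {..-x} = measure M {\<omega>\<in>space M. X 0 \<omega> \<le> - x}" for x
          unfolding \<mu>_def by (auto simp: measure_distr vimage_def Int_def conj_commute)
        moreover have "\<forall>\<^sub>F x in at_top. l x > 0" using l_sv unfolding slowly_varying_def by simp
        ultimately show ?thesis
          by (auto elim!: eventually_mono simp: add_divide_distrib[symmetric] distrib_left[symmetric])
      qed
      ultimately show ?thesis by (auto intro: Lim_transform_eventually)
    qed
    show "((\<lambda>x. \<mu>.trunc_moment2 x / h x) \<longlongrightarrow> 1) at_top" if "\<alpha> = 2"
    proof -
      have "\<mu>.trunc_moment2 x = integral\<^sup>L M (\<lambda>\<omega>. if \<bar>X 0 \<omega>\<bar> \<le> x then (X 0 \<omega>)\<^sup>2 else 0)" for x
        unfolding \<mu>.trunc_moment2_def unfolding \<mu>_def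
        by (subst integral_distr) (auto intro!: Bochner_Integration.integral_cong split: split_indicator)
      then have "\<mu>.trunc_moment2 = (\<lambda>x. integral\<^sup>L M (\<lambda>\<omega>. if \<bar>X 0 \<omega>\<bar> \<le> x then (X 0 \<omega>)\<^sup>2 else 0))" ..
      then have "h \<sim>[at_top] \<mu>.trunc_moment2" using h_eq2[OF that] by simp
      then show ?thesis
        by (rule asymp_equivD_strong[OF asymp_equiv_symI]) (use h_ne in \<open>eventually_elim, simp\<close>)
    qed
    show "integrable \<mu> (\<lambda>y. y) \<and> (\<integral>y. y \<partial>\<mu>) = 0" if "1 < \<alpha>"
      using mean0[OF that] unfolding \<mu>_def by (simp add: integrable_distr_eq integral_distr)
  qed (use alpha cs h_low in auto)
  obtain u v where atoms: "u \<noteq> v" "measure \<mu> {u} > 0" "measure \<mu> {v} > 0"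
    using \<mu>.lattice_two_atoms[OF lat span] by blast
  have L_nonneg: "0 \<le> L n" if "n \<ge> 1" for n using L_def[OF that] by simp
  \<comment> \<open>L is eliminated from its two defining equations; positivity of h(b_n) is what
    allows the power 1/\<alpha> to be undone.\<close>
  have b_eq: "b n powr \<alpha> = n * h (b n)" if "n \<ge> 1" "0 < h (b n)" for n
  proof -
    have "b n powr \<alpha> = L n powr \<alpha> * (n powr (1 / \<alpha>)) powr \<alpha>"
      using b_def[OF that(1)] L_nonneg[OF that(1)] by (simp add: powr_mult)
    also have "L n powr \<alpha> = h (b n)"
      using that alpha by (simp add: L_def powr_powr)
    finally show ?thesis using that alpha by (simp add: powr_powr)
  qed
  obtain B where B: "\<And>m. m \<ge> 1 \<Longrightarrow> b m * (\<integral>t. indicator {-pi..pi} t * norm (char \<mu> t) ^ m \<partial>lborel) \<le> B"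
    using SA.integral_char_power_le[of u v b, OF atoms span b_pos b_eq] by blast
  obtain c x1 where c: "c > 0" "x1 > 0" and dec: "\<And>t. t \<noteq> 0 \<Longrightarrow> \<bar>t\<bar> \<le> 1 / x1 \<Longrightarrow>
      norm (char \<mu> t) \<le> exp (- (c * (\<bar>t\<bar> powr \<alpha> * h (1 / \<bar>t\<bar>))))"
    using SA.norm_char_le_exp_h[OF atoms] by blast
  obtain A0 x2 where x2: "x2 > 0" and near0: "\<And>t. t \<noteq> 0 \<Longrightarrow> \<bar>t\<bar> \<le> 1 / x2 \<Longrightarrow>
      norm (char \<mu> t - 1) \<le> A0 * (\<bar>t\<bar> powr \<alpha> * h (1 / \<bar>t\<bar>))"
    using SA.norm_char_minus_1_le_h by blast
  obtain c0 x3 where c0: "c0 > 0" and x3: "\<And>x. x \<ge> x3 \<Longrightarrow> c0 \<le> h x"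
    using h_low unfolding eventually_at_top_linorder by blast
  obtain a0 where a0: "a0 > 0" "continuous_on {a0..} h" using h_cont by blast
  \<comment> \<open>A common threshold: x1 and x2 for the two bounds on \<phi>, x3 for h \<ge> c0,
    a0 for the continuity of h, which makes M finite by compactness, and 1 for \<epsilon> \<le> 1
    \<le> pi.\<close>
  define x0 where "x0 = Max {x1, x2, x3, a0, 1}"
  have x0: "x1 \<le> x0" "x2 \<le> x0" "x3 \<le> x0" "a0 \<le> x0" "1 \<le> x0" by (auto simp: x0_def)
  define \<epsilon> where "\<epsilon> = 1 / x0"
  have eps: "0 < \<epsilon>" "\<epsilon> \<le> 1" "1 / \<epsilon> = x0" "\<epsilon> \<le> 1 / x1" "\<epsilon> \<le> 1 / x2"
    using x0 c x2 by (auto simp: \<epsilon>_def intro!: divide_left_mono)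
  have inv: "x0 \<le> 1 / \<bar>t\<bar>" if "t \<noteq> 0" "\<bar>t\<bar> \<le> \<epsilon>" for t
    using that x0 by (simp add: \<epsilon>_def field_simps)
  have h0: "c0 \<le> h (1 / \<bar>t\<bar>)" if "t \<noteq> 0" "\<bar>t\<bar> \<le> \<epsilon>" for t
    using inv[OF that] x0 by (intro x3) linarith
  obtain d where d: "d > 0" and away: "\<And>t. \<epsilon> \<le> \<bar>t\<bar> \<Longrightarrow> \<bar>t\<bar> \<le> pi \<Longrightarrow> norm (char \<mu> t) \<le> exp (- d)"
    using \<mu>.norm_char_bounded_away[OF span eps(1)] by blast
  \<comment> \<open>Here h is traded for its lower bound c0, so that |\<phi>|^(n-m) is dominated
    near 0 by a pure stretched exponential.\<close>
  define c' where "c' = c * c0"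
  have c': "c' > 0" using c c0 by (simp add: c'_def)
  have decay: "norm (char \<mu> t) \<le> exp (- (c' * \<bar>t\<bar> powr \<alpha>))" if t: "t \<noteq> 0" "\<bar>t\<bar> \<le> \<epsilon>" for t
  proof -
    have "c * (\<bar>t\<bar> powr \<alpha> * c0) \<le> c * (\<bar>t\<bar> powr \<alpha> * h (1 / \<bar>t\<bar>))"
      using h0[OF t] c by (intro mult_left_mono) auto
    then have "exp (- (c * (\<bar>t\<bar> powr \<alpha> * h (1 / \<bar>t\<bar>)))) \<le> exp (- (c' * \<bar>t\<bar> powr \<alpha>))"
      by (simp add: c'_def mult_ac)
    with dec[of t] t eps(4) show ?thesis by linarith
  qed
  define A where "A = max A0 0"
  have A: "A \<ge> 0" by (simp add: A_def)
  have near1: "norm (char \<mu> t - 1) \<le> A * (\<bar>t\<bar> powr \<alpha> * h (1 / \<bar>t\<bar>))" if t: "t \<noteq> 0" "\<bar>t\<bar> \<le> \<epsilon>" for t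
  proof -
    have "A0 * (\<bar>t\<bar> powr \<alpha> * h (1 / \<bar>t\<bar>)) \<le> A * (\<bar>t\<bar> powr \<alpha> * h (1 / \<bar>t\<bar>))"
      using h0[OF t] c0 by (intro mult_right_mono mult_nonneg_nonneg) (auto simp: A_def)
    with near0[of t] t eps(5) show ?thesis by linarith
  qed
  have bdd: "bdd_above (h ` {x0..x})" for x
    using a0(2) x0(4)
    by (intro bounded_imp_bdd_above compact_imp_bounded compact_continuous_image)
       (auto intro: continuous_on_subset)
  obtain K where K: "K > 0" "\<And>n. \<bar>\<kappa> n / b n\<bar> \<le> K"
    using convergent_imp_Bseq[OF convergentI[OF kappa_lim]] by (auto elim!: BseqE)
  have \<kappa>_le: "\<bar>\<kappa> n\<bar> \<le> K * b n" if "n \<ge> 1" for n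
    using K(2)[of n] b_pos[OF that] by (simp add: abs_divide field_simps)

  have main: "\<exists>C. \<forall>m n::nat. m \<ge> 1 \<and> real n > real m + \<epsilon> powr (- \<alpha> / (\<alpha> + 1)) \<longrightarrow>
       b m * b n *
         \<bar>measure M {\<omega>\<in>space M. S m \<omega> = \<kappa> m \<and> S n \<omega> = \<kappa> n}
          - measure M {\<omega>\<in>space M. S m \<omega> = \<kappa> m} * measure M {\<omega>\<in>space M. S n \<omega> = \<kappa> n}\<bar>
       \<le> C * L n *
         (real n powr (1 / \<alpha>) * (exp (- (real (n - m)) * d) + exp (- real n * d))
          + (real m / real n) / (1 - real m / real n) powr (1 + 1 / \<alpha>)
              * (1 + Sup (h ` {1/\<epsilon>..real n powr (1 + 1 / \<alpha>)}))
          + (real m / real n) powr (\<eta> / \<alpha>) * L m powr \<eta>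
              / (1 - real m / real n) powr ((\<eta> + 1) / \<alpha>))" if eta: "0 < \<eta>" "\<eta> \<le> 1" for \<eta>
  proof -
    define J where "J = (\<lambda>p. \<integral>t. \<bar>t\<bar> powr p * exp (- (\<bar>t\<bar> powr \<alpha>)) \<partial>lborel)"
    have J: "J p \<ge> 0" for p unfolding J_def by (intro integral_nonneg_AE) auto
    define D2 where "D2 = A * J \<alpha> * c' powr (- ((\<alpha> + 1) / \<alpha>))"
    define D3 where "D3 = 2 * K powr \<eta> * J \<eta> * c' powr (- ((\<eta> + 1) / \<alpha>))"
    have D: "D2 \<ge> 0" "D3 \<ge> 0" using J A by (auto simp: D2_def D3_def)
    \<comment> \<open>4 pi, 4 + D2 and D3 belong to the three groups of terms in the claim, the 4 in
      the middle stemming from the cutoff. \<eta> enters only through D3. C then divides by 2 pi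
      once for each of the two Fourier estimates.\<close>
    define D where "D = 4 * pi + (4 + D2) + D3"
    define C where "C = (B / (2 * pi)) * (D / (2 * pi))"
    show ?thesis
    proof (intro exI[of _ C] allI impI, elim conjE)
      fix m n :: nat assume m: "m \<ge> 1" and n: "real n > real m + \<epsilon> powr (- \<alpha> / (\<alpha> + 1))"
      have mn: "m < n" using n powr_ge_zero[of \<epsilon> "- \<alpha> / (\<alpha> + 1)"] by linarith
      then have n1: "n \<ge> 1" by simp
      define N where "N = n - m"
      have N: "N > 0" "real N = real n - real m" using mn by (auto simp: N_def)
      define H where "H = Sup (h ` {1/\<epsilon>..real n powr (1 + 1 / \<alpha>)})"
      define \<tau> where "\<tau> = real n powr (- (1 + 1 / \<alpha>))"
      have \<tau>: "\<tau> > 0" using n1 by (simp add: \<tau>_def)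
      \<comment> \<open>The exponents -\<alpha>/(\<alpha>+1) and 1 + 1/\<alpha> have product -1, so
        the required gap between n and m forces n^(1+1/\<alpha>) to be at least 1/\<epsilon>. Hence
        the supremum H is over a nonempty range and inherits h(x0) \<ge> c0 > 0.\<close>
      have x0_le: "x0 \<le> real n powr (1 + 1 / \<alpha>)"
      proof -
        have "x0 = (\<epsilon> powr (- \<alpha> / (\<alpha> + 1))) powr (1 + 1 / \<alpha>)"
        proof -
          have "1 + 1 / \<alpha> = (\<alpha> + 1) / \<alpha>" using alpha by (simp add: add_divide_distrib)
          then have exponent: "- \<alpha> / (\<alpha> + 1) * (1 + 1 / \<alpha>) = - 1" using alpha by simp
          show ?thesis unfolding powr_powr exponent using eps(1,3) by (simp add: powr_minus_divide)
        qed
        also have "\<dots> \<le> real n powr (1 + 1 / \<alpha>)"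
          using n alpha by (intro powr_mono2) auto
        finally show ?thesis .
      qed
      have H_ge: "h x \<le> H" if "x0 \<le> x" "x \<le> real n powr (1 + 1 / \<alpha>)" for x
        unfolding H_def eps(3) using that bdd by (intro cSup_upper) auto
      have H: "H \<ge> 0" using H_ge[OF order_refl x0_le] x3[OF x0(3)] c0 by linarith
      have hH: "h (1 / \<bar>t\<bar>) \<le> H" if "\<tau> \<le> \<bar>t\<bar>" "\<bar>t\<bar> \<le> \<epsilon>" for t
      proof (rule H_ge)
        have t: "t \<noteq> 0" using that \<tau> by auto
        show "x0 \<le> 1 / \<bar>t\<bar>" using inv t that by blast
        have "1 / \<bar>t\<bar> \<le> 1 / \<tau>" using that \<tau> by (intro divide_left_mono) auto
        also have "1 / \<tau> = real n powr (1 + 1 / \<alpha>)" unfolding \<tau>_def powr_minus_divide by simp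
        finally show "1 / \<bar>t\<bar> \<le> real n powr (1 + 1 / \<alpha>)" .
      qed

      define Pm where "Pm = measure M {\<omega>\<in>space M. S m \<omega> = \<kappa> m}"
      define Pn where "Pn = measure M {\<omega>\<in>space M. S n \<omega> = \<kappa> n}"
      define Pd where "Pd = measure M {\<omega>\<in>space M. (\<Sum>i\<in>{m..<n}. X i \<omega>) = \<kappa> n - \<kappa> m}"
      define \<nu> where "\<nu> = (\<lambda>I. distr M borel (\<lambda>\<omega>. \<Sum>i\<in>I. X i \<omega>))"
      have \<nu>: "real_distribution (\<nu> I)" "char (\<nu> I) t = char \<mu> t ^ card I" for I t
        unfolding \<nu>_def by (simp_all add: char_distr_iid_sum[OF indep dist])
      have \<nu>_lat: "AE x in \<nu> I. x - y \<in> \<int>" if "finite I" "y \<in> lattice_pts (real (card I) * a) 1" for I y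
      proof -
        have "AE \<omega> in M. \<forall>i\<in>I. X i \<omega> \<in> lattice_pts a 1"
        proof (subst AE_finite_all[OF that(1)], rule ballI)
          fix i
          have "AE x in distr M borel (X i). x \<in> lattice_pts a 1" unfolding dist by (rule lat)
          then show "AE \<omega> in M. X i \<omega> \<in> lattice_pts a 1"
            by (rule AE_distrD[rotated]) simp
        qed
        then have "AE \<omega> in M. (\<Sum>i\<in>I. X i \<omega>) - y \<in> \<int>"
          by eventually_elim (rule sum_minus_lattice_pt_in_Ints[OF that(1) _ that(2)], blast)
        moreover have "{x. x - y \<in> \<int>} \<in> sets borel"
        proof -
          have "x \<in> lattice_pts y 1" if "x - y \<in> \<int>" for x
            using Ints_cases[OF that] by (auto simp: lattice_pts_def algebra_simps)
          then have "countable {x. x - y \<in> \<int>}"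
            by (intro countable_subset[OF _ countable_lattice_pts[of y 1]]) auto
          then show ?thesis by (rule sets.countable[rotated]) simp
        qed
        ultimately show ?thesis
          unfolding \<nu>_def by (subst AE_distr_iff) auto
      qed
      have \<nu>_meas: "measure (\<nu> I) {y} = measure M {\<omega>\<in>space M. (\<Sum>i\<in>I. X i \<omega>) = y}" for I y
        unfolding \<nu>_def by (auto simp: measure_distr vimage_def Int_def conj_commute)
      have \<kappa>_diff: "\<kappa> n - \<kappa> m \<in> lattice_pts (real (card {m..<n}) * a) 1"
      proof -
        obtain j k :: int where "\<kappa> n = real n * a + of_int j" "\<kappa> m = real m * a + of_int k"
          using kappa_lat[of n] kappa_lat[of m] by (auto simp: lattice_pts_def)
        then have "\<kappa> n - \<kappa> m = real (card {m..<n}) * a + 1 * of_int (j - k)"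
          using mn by (simp add: of_nat_diff algebra_simps)
        then show ?thesis unfolding lattice_pts_def by blast
      qed
      have Pm_le: "b m * Pm \<le> B / (2 * pi)"
      proof -
        have "Pm \<le> (\<integral>t. indicator {-pi..pi} t * norm (char (\<nu> {..<m}) t) \<partial>lborel) / (2 * pi)"
          unfolding Pm_def S_def \<nu>_meas[symmetric] using kappa_lat[of m]
          by (intro lattice_local_prob_le \<nu> \<nu>_lat) auto
        then have "b m * Pm \<le> b m * ((\<integral>t. indicator {-pi..pi} t * norm (char (\<nu> {..<m}) t) \<partial>lborel) / (2 * pi))"
          using b_pos[OF m] by (intro mult_left_mono) auto
        also have "\<dots> \<le> B / (2 * pi)"
          using divide_right_mono[OF B[OF m], of "2 * pi"] by (simp add: \<nu>(2) norm_power)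
        finally show ?thesis .
      qed
      have diff_le: "\<bar>Pd - Pn\<bar> \<le> (4 * pi * exp (- d * real N)
          + 2 * \<bar>\<kappa> m\<bar> powr \<eta> * J \<eta> * (c' * real N) powr (- ((\<eta> + 1) / \<alpha>)) + 4 * real m * \<tau>
          + real m * A * H * J \<alpha> * (c' * real N) powr (- ((\<alpha> + 1) / \<alpha>))) / (2 * pi)"
      proof -
        have "\<bar>Pd - Pn\<bar> \<le> (\<integral>t. indicator {-pi..pi} t * norm (iexp (- (t * (\<kappa> n - \<kappa> m))) * char (\<nu> {m..<n}) t
            - iexp (- (t * \<kappa> n)) * char (\<nu> {..<n}) t) \<partial>lborel) / (2 * pi)"
          unfolding Pd_def Pn_def S_def \<nu>_meas[symmetric] using kappa_lat[of n] \<kappa>_diff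
          by (intro lattice_local_prob_diff_le \<nu> \<nu>_lat) auto
        \<comment> \<open>Both terms share the phase exp(-i t \<kappa>_n), of modulus 1, and the
          power \<phi>^(n-m).\<close>
        also have "(\<lambda>t. norm (iexp (- (t * (\<kappa> n - \<kappa> m))) * char (\<nu> {m..<n}) t
            - iexp (- (t * \<kappa> n)) * char (\<nu> {..<n}) t))
            = (\<lambda>t. norm (char \<mu> t) ^ N * norm (iexp (t * \<kappa> m) - char \<mu> t ^ m))"
        proof
          fix t
          have "char \<mu> t ^ n = char \<mu> t ^ N * char \<mu> t ^ m"
            using mn by (simp add: N_def power_add[symmetric])
          moreover have "iexp (- (t * (\<kappa> n - \<kappa> m))) = iexp (- (t * \<kappa> n)) * iexp (t * \<kappa> m)"
            by (simp add: exp_add[symmetric] algebra_simps)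
          ultimately have "iexp (- (t * (\<kappa> n - \<kappa> m))) * char (\<nu> {m..<n}) t - iexp (- (t * \<kappa> n)) * char (\<nu> {..<n}) t
              = iexp (- (t * \<kappa> n)) * (char \<mu> t ^ N * (iexp (t * \<kappa> m) - char \<mu> t ^ m))"
            unfolding \<nu>(2) by (simp add: N_def algebra_simps)
          then have "norm (iexp (- (t * (\<kappa> n - \<kappa> m))) * char (\<nu> {m..<n}) t - iexp (- (t * \<kappa> n)) * char (\<nu> {..<n}) t)
              = norm (iexp (- (t * \<kappa> n))) * (norm (char \<mu> t) ^ N * norm (iexp (t * \<kappa> m) - char \<mu> t ^ m))"
            by (simp only: norm_mult norm_power)
          then show "norm (iexp (- (t * (\<kappa> n - \<kappa> m))) * char (\<nu> {m..<n}) t - iexp (- (t * \<kappa> n)) * char (\<nu> {..<n}) t)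
              = norm (char \<mu> t) ^ N * norm (iexp (t * \<kappa> m) - char \<mu> t ^ m)"
            by (simp only: norm_exp_i_times mult_1)
        qed
        also have "(\<integral>t. indicator {-pi..pi} t * (norm (char \<mu> t) ^ N * norm (iexp (t * \<kappa> m) - char \<mu> t ^ m)) \<partial>lborel) / (2 * pi)
            \<le> (4 * pi * exp (- d * real N)
              + 2 * \<bar>\<kappa> m\<bar> powr \<eta> * J \<eta> * (c' * real N) powr (- ((\<eta> + 1) / \<alpha>)) + 4 * real m * \<tau>
              + real m * A * H * J \<alpha> * (c' * real N) powr (- ((\<alpha> + 1) / \<alpha>))) / (2 * pi)"
        proof (rule divide_right_mono)
          have "\<epsilon> \<le> pi" using eps(2) pi_gt3 by linarith
          then show "(\<integral>t. indicator {-pi..pi} t * (norm (char \<mu> t) ^ N * norm (iexp (t * \<kappa> m) - char \<mu> t ^ m)) \<partial>lborel)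
            \<le> 4 * pi * exp (- d * real N)
              + 2 * \<bar>\<kappa> m\<bar> powr \<eta> * J \<eta> * (c' * real N) powr (- ((\<eta> + 1) / \<alpha>)) + 4 * real m * \<tau>
              + real m * A * H * J \<alpha> * (c' * real N) powr (- ((\<alpha> + 1) / \<alpha>))"
            unfolding J_def
            by (rule \<mu>.integral_char_powers_diff_le[OF eps(1) _ alpha(1) eta c' A H \<tau> N(1) away decay near1 hH])
        qed simp
        finally show ?thesis .
      qed
      define T1 where "T1 = real n powr (1 / \<alpha>) * (exp (- (real (n - m)) * d) + exp (- real n * d))"
      define T2 where "T2 = (real m / real n) / (1 - real m / real n) powr (1 + 1 / \<alpha>)
          * (1 + Sup (h ` {1/\<epsilon>..real n powr (1 + 1 / \<alpha>)}))"
      define T3 where "T3 = (real m / real n) powr (\<eta> / \<alpha>) * L m powr \<eta>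
          / (1 - real m / real n) powr ((\<eta> + 1) / \<alpha>)"
      have ratio: "0 < 1 - real m / real n" "1 - real m / real n \<le> 1" using mn by auto
      note rates = rate_identities[where x = "real m" and y = "real n" and \<alpha> = \<alpha>]
      have scaled: "real n powr (1/\<alpha>) * (4 * pi * exp (- d * real N)
          + 2 * \<bar>\<kappa> m\<bar> powr \<eta> * J \<eta> * (c' * real N) powr (- ((\<eta> + 1) / \<alpha>)) + 4 * real m * \<tau>
          + real m * A * H * J \<alpha> * (c' * real N) powr (- ((\<alpha> + 1) / \<alpha>))) \<le> D * (T1 + T2 + T3)"
      proof -
        have e1: "real n powr (1/\<alpha>) * (4 * pi * exp (- d * real N)) \<le> 4 * pi * T1"
          unfolding T1_def N_def by (simp add: mult_ac distrib_left)
        have e2: "real n powr (1/\<alpha>) * (2 * \<bar>\<kappa> m\<bar> powr \<eta> * J \<eta> * (c' * real N) powr (- ((\<eta> + 1) / \<alpha>))) \<le> D3 * T3"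
        proof -
          \<comment> \<open>Boundedness of \<kappa>_m/b_m brings in b_m = L(m) m^(1/\<alpha>), the
            source of L(m)^\<eta> and of the exponent \<eta>/\<alpha> on m.\<close>
          have "\<bar>\<kappa> m\<bar> powr \<eta> \<le> (K * b m) powr \<eta>"
            using \<kappa>_le[OF m] eta by (intro powr_mono2) auto
          also have "\<dots> = K powr \<eta> * (L m powr \<eta> * real m powr (\<eta> / \<alpha>))"
            using K L_nonneg[OF m] by (simp add: b_def[OF m] powr_mult powr_powr)
          finally have "real n powr (1/\<alpha>) * (2 * \<bar>\<kappa> m\<bar> powr \<eta> * J \<eta> * (c' * real N) powr (- ((\<eta> + 1) / \<alpha>)))
              \<le> real n powr (1/\<alpha>) * (2 * (K powr \<eta> * (L m powr \<eta> * real m powr (\<eta> / \<alpha>))) * J \<eta>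
                * (c' * real N) powr (- ((\<eta> + 1) / \<alpha>)))"
            using J by (intro mult_left_mono mult_right_mono) auto
          also have "\<dots> = D3 * L m powr \<eta> * (real n powr (1/\<alpha>) * (real m powr (\<eta> / \<alpha>) * (real n - real m) powr (- ((\<eta> + 1) / \<alpha>))))"
            using c' N(2) mn by (simp add: D3_def powr_mult mult_ac)
          also have "\<dots> = D3 * T3"
            using rates(1) m mn alpha by (simp add: T3_def)
          finally show ?thesis .
        qed
        \<comment> \<open>The cutoff contributes a bare multiple of m/n. Division by a number in (0,
          1] only enlarges m/n, which places the contribution under the summand 1 of 1 + H.\<close>
        have fac: "real m / real n \<le> (real m / real n) / (1 - real m / real n) powr (1 + 1 / \<alpha>)"
        proof -
          have "(1 - real m / real n) powr (1 + 1 / \<alpha>) \<le> 1"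
            using ratio alpha by (intro powr_le1) auto
          moreover have "(1 - real m / real n) powr (1 + 1 / \<alpha>) > 0" using mn by simp
          moreover have "x \<le> x / z" if "z \<le> 1" "0 < z" "0 \<le> x" for x z :: real
            using that by (simp add: le_divide_eq mult_left_le)
          ultimately show ?thesis by (metis divide_nonneg_nonneg of_nat_0_le_iff)
        qed
        have T2_eq: "T2 = (real m / real n) / (1 - real m / real n) powr (1 + 1 / \<alpha>) * (1 + H)"
          by (simp add: T2_def H_def)
        have e3: "real n powr (1/\<alpha>) * (4 * real m * \<tau>) \<le> 4 * T2"
        proof -
          have "real n powr (1/\<alpha>) * (4 * real m * \<tau>) = 4 * (real m / real n * 1)"
            using rates(3) m mn alpha by (simp add: \<tau>_def)
          also have "\<dots> \<le> 4 * T2"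
            unfolding T2_eq using fac H by (intro mult_left_mono mult_mono) auto
          finally show ?thesis .
        qed
        have e4: "real n powr (1/\<alpha>) * (real m * A * H * J \<alpha> * (c' * real N) powr (- ((\<alpha> + 1) / \<alpha>))) \<le> D2 * T2"
        proof -
          have "real n powr (1/\<alpha>) * (real m * A * H * J \<alpha> * (c' * real N) powr (- ((\<alpha> + 1) / \<alpha>)))
              = D2 * (real n powr (1/\<alpha>) * (real m * (real n - real m) powr (- ((\<alpha> + 1) / \<alpha>))) * H)"
            using c' N(2) mn by (simp add: D2_def powr_mult mult_ac)
          also have "\<dots> = D2 * ((real m / real n) / (1 - real m / real n) powr (1 + 1 / \<alpha>) * H)"
            using rates(2) m mn alpha by simp
          also have "\<dots> \<le> D2 * T2"
            unfolding T2_eq using D H by (intro mult_left_mono) auto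
          finally show ?thesis .
        qed
        have T: "0 \<le> T1" "0 \<le> T2" "0 \<le> T3"
          using H by (auto simp: T1_def T2_eq T3_def)
        have "4 * pi * T1 \<le> D * T1" "(4 + D2) * T2 \<le> D * T2" "D3 * T3 \<le> D * T3"
          using T D pi_gt_zero by (auto simp: D_def intro!: mult_right_mono)
        then show ?thesis
          using e1 e2 e3 e4 unfolding distrib_left distrib_right by linarith
      qed
      have prob_diff: "measure M {\<omega>\<in>space M. S m \<omega> = \<kappa> m \<and> S n \<omega> = \<kappa> n} - Pm * Pn = Pm * (Pd - Pn)"
        using prob_eq_and_sum_eq[OF indep, of m n "\<kappa> m" "\<kappa> n"] mn
        by (simp add: Pm_def Pd_def S_def right_diff_distrib)
      have Pm0: "0 \<le> Pm" by (simp add: Pm_def)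
      have bn0: "0 \<le> b n" using b_pos[OF n1] by simp
      \<comment> \<open>b_m is spent on the first factor, giving a constant, and b_n = L(n)
        n^(1/\<alpha>) on the second.\<close>
      have "b m * b n * \<bar>Pm * (Pd - Pn)\<bar> = (b m * Pm) * (b n * \<bar>Pd - Pn\<bar>)"
        using Pm0 by (simp add: abs_mult)
      also have "\<dots> \<le> (B / (2 * pi)) * (L n * (D * (T1 + T2 + T3) / (2 * pi)))"
      proof (rule mult_mono[OF Pm_le])
        have "b n * \<bar>Pd - Pn\<bar> \<le> b n * ((4 * pi * exp (- d * real N)
            + 2 * \<bar>\<kappa> m\<bar> powr \<eta> * J \<eta> * (c' * real N) powr (- ((\<eta> + 1) / \<alpha>)) + 4 * real m * \<tau>
            + real m * A * H * J \<alpha> * (c' * real N) powr (- ((\<alpha> + 1) / \<alpha>))) / (2 * pi))"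
          using diff_le bn0 by (rule mult_left_mono)
        also have "\<dots> = L n * (real n powr (1/\<alpha>) * (4 * pi * exp (- d * real N)
            + 2 * \<bar>\<kappa> m\<bar> powr \<eta> * J \<eta> * (c' * real N) powr (- ((\<eta> + 1) / \<alpha>)) + 4 * real m * \<tau>
            + real m * A * H * J \<alpha> * (c' * real N) powr (- ((\<alpha> + 1) / \<alpha>))) / (2 * pi))"
          by (simp only: b_def[OF n1] times_divide_eq_right mult.assoc)
        also have "\<dots> \<le> L n * (D * (T1 + T2 + T3) / (2 * pi))"
          using scaled L_nonneg[OF n1] by (intro mult_left_mono divide_right_mono) auto
        finally show "b n * \<bar>Pd - Pn\<bar> \<le> L n * (D * (T1 + T2 + T3) / (2 * pi))" .
        have "0 \<le> b m * Pm" using b_pos[OF m] Pm0 by simp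
        with Pm_le show "0 \<le> B / (2 * pi)" by linarith
        show "0 \<le> b n * \<bar>Pd - Pn\<bar>" using bn0 by simp
      qed
      also have "\<dots> = C * L n * (T1 + T2 + T3)" by (simp add: C_def)
      finally show "b m * b n *
         \<bar>measure M {\<omega>\<in>space M. S m \<omega> = \<kappa> m \<and> S n \<omega> = \<kappa> n}
          - measure M {\<omega>\<in>space M. S m \<omega> = \<kappa> m} * measure M {\<omega>\<in>space M. S n \<omega> = \<kappa> n}\<bar>
       \<le> C * L n *
         (real n powr (1 / \<alpha>) * (exp (- (real (n - m)) * d) + exp (- real n * d))
          + (real m / real n) / (1 - real m / real n) powr (1 + 1 / \<alpha>)
              * (1 + Sup (h ` {1/\<epsilon>..real n powr (1 + 1 / \<alpha>)}))
          + (real m / real n) powr (\<eta> / \<alpha>) * L m powr \<eta>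
              / (1 - real m / real n) powr ((\<eta> + 1) / \<alpha>))"
        unfolding T1_def[symmetric] T2_def[symmetric] T3_def[symmetric] Pm_def[symmetric] Pn_def[symmetric] prob_diff .
    qed
  qed
  show ?thesis
    using eps(1) d bdd main eps(3) by (intro exI[of _ \<epsilon>] exI[of _ d]) auto
qed

end
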